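(* Let $N\ge1$, let $e_1,\dots,e_N\in\mathbb{R}$, and let $f_{0\alpha}=f_{0\alpha}(x,v)\ge0$, $\alpha=1,\dots,N$, be $C^1$ and compactly supported on $\mathbb{R}\times\mathbb{R}^2$ and satisfy the neutrality condition $$\iint\sum_\alpha e_\alpha f_{0\alpha}(x,v)\,dv\,dx=0.$$ Let $f_\alpha(t,x,v)$, $\alpha=1,\dots,N$, be the corresponding global solution of the multi-species relativistic Vlasov-Poisson system with $f_\alpha(0,x,v)=f_{0\alpha}(x,v)$, and define $$Q_1(t)=\sup\Big\{|v_1| : \text{there are } x,v_2\in\mathbb{R}\text{ such that } \sum_\alpha f_\alpha(t,x,v_1,v_2)\ne0\Big\}.$$ Then there is $C>0$ such that for any $t\ge0$, $$Q_1(t)\le C\sqrt{1+t}.$$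
   Context: The multi-species ``one and one-half dimensional'' relativistic Vlasov-Poisson system, for the unknowns $f_\alpha=f_\alpha(t,x,v)\ge0$ (number density of species $\alpha$ with charge $e_\alpha$), $\alpha=1,\dots,N$, $t\ge0$, $x\in\mathbb{R}$, $v=(v_1,v_2)\in\mathbb{R}^2$, is $$\partial_tf_\alpha+\hat v_1\,\partial_xf_\alpha+e_\alpha E_1\,\partial_{v_1}f_\alpha=0,\qquad \rho(t,x)=\int_{\mathbb{R}^2}\sum_\alpha e_\alpha f_\alpha(t,x,v)\,dv,$$ $$E_1(t,x)=\frac12\left(\int_{-\infty}^x\rho(t,y)\,dy-\int_x^\infty\rho(t,y)\,dy\right),$$ where $\hat v=v/\sqrt{1+|v|^2}$. For initial data that are $C^1$, nonnegative and compactly supported, it is known that there is a solution that is $C^1$ for all $t\ge0$, with each $f_\alpha(t,\cdot,\cdot)$ compactly supported for each $t\ge0$; solutions are understood in this sense. The constant $C$ may depend on the data and the charges but not on $t$. If all $f_\alpha$ vanish identically, the supremum of the empty set is taken to be $0$. *)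

theory Defs
  imports "HOL-Analysis.Analysis"
begin

text \<open>
  Species are numbered by \<open>\<alpha> \<in> {1..N}\<close>; \<open>f \<alpha> t x v\<close> is the number density of species \<open>\<alpha>\<close>,
  with momentum \<open>v = (v\<^sub>1, v\<^sub>2)\<close> in \<^typ>\<open>real \<times> real\<close>, whose norm is the Euclidean one.
  Only times \<open>t \<ge> 0\<close> are constrained by the definitions below.
\<close>

text \<open>
  The derivative is taken within \<open>S\<close>, so that on \<open>{0..} \<times> UNIV\<close> it is one-sided in the time
  variable at time 0.
\<close>
definition C1_on :: "'a::real_normed_vector set \<Rightarrow> ('a \<Rightarrow> 'b::real_normed_vector) \<Rightarrow> bool" where
  "C1_on S g \<longleftrightarrow>
     (\<exists>g' :: 'a \<Rightarrow> 'a \<Rightarrow>\<^sub>L 'b.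
        (\<forall>z\<in>S. (g has_derivative blinfun_apply (g' z)) (at z within S)) \<and> continuous_on S g')"

definition compactly_supported :: "('a::topological_space \<Rightarrow> real) \<Rightarrow> bool" where
  "compactly_supported g \<longleftrightarrow> compact (closure {z. g z \<noteq> 0})"

definition vhat :: "real \<times> real \<Rightarrow> real \<times> real" where
  "vhat v = v /\<^sub>R sqrt (1 + (norm v)\<^sup>2)"

type_synonym densities = "nat \<Rightarrow> real \<Rightarrow> real \<Rightarrow> real \<times> real \<Rightarrow> real"

definition rho :: "nat \<Rightarrow> (nat \<Rightarrow> real) \<Rightarrow> densities \<Rightarrow> real \<Rightarrow> real \<Rightarrow> real" where
  "rho N e f t x = (LINT v|lborel. (\<Sum>\<alpha>\<in>{1..N}. e \<alpha> * f \<alpha> t x v))"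

definition E1 :: "nat \<Rightarrow> (nat \<Rightarrow> real) \<Rightarrow> densities \<Rightarrow> real \<Rightarrow> real \<Rightarrow> real" where
  "E1 N e f t x =
     ((LINT y:{..x}|lborel. rho N e f t y) - (LINT y:{x..}|lborel. rho N e f t y)) / 2"

definition vlasov_poisson_solution :: "nat \<Rightarrow> (nat \<Rightarrow> real) \<Rightarrow> densities \<Rightarrow> bool" where
  "vlasov_poisson_solution N e f \<longleftrightarrow>
     (\<forall>\<alpha>\<in>{1..N}.
        C1_on ({0..} \<times> UNIV) (\<lambda>(t, x, v). f \<alpha> t x v) \<and>
        (\<forall>t\<ge>0. compactly_supported (\<lambda>(x, v). f \<alpha> t x v)) \<and>
        (\<forall>t\<ge>0. \<forall>x v. f \<alpha> t x v \<ge> 0) \<and>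
        (\<forall>t\<ge>0. \<forall>x v1 v2. \<exists>ft fx fv1.
           ((\<lambda>s. f \<alpha> s x (v1, v2)) has_real_derivative ft) (at t within {0..}) \<and>
           ((\<lambda>y. f \<alpha> t y (v1, v2)) has_real_derivative fx) (at x) \<and>
           ((\<lambda>w. f \<alpha> t x (w, v2)) has_real_derivative fv1) (at v1) \<and>
           ft + fst (vhat (v1, v2)) * fx + e \<alpha> * E1 N e f t x * fv1 = 0))"

text \<open>
  The supremum of the empty set is 0 here, whereas \<^term>\<open>Sup {} :: real\<close> is unspecified.
\<close>
definition Q1 :: "nat \<Rightarrow> densities \<Rightarrow> real \<Rightarrow> real" where
  "Q1 N f t =
     (let A = {\<bar>v1\<bar> | v1. \<exists>x v2. (\<Sum>\<alpha>\<in>{1..N}. f \<alpha> t x (v1, v2)) \<noteq> 0}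
      in if A = {} then 0 else Sup A)"

end

theory Submission
  imports Defs
begin

text \<open>
  Proof idea. Let \<open>Q\<close> be the maximal \<open>\<bar>v\<^sub>1\<bar>\<close> on the supports up to time \<open>T\<close>. By neutrality the field
  energy is finite, and the energy density \<open>A = \<Sum>\<^sub>\<alpha> \<integral> sqrt (1 + \<bar>v\<bar>\<^sup>2) f\<^sub>\<alpha> dv + E\<^sub>1\<^sup>2 / 2\<close> satisfies
  \<open>\<partial>\<^sub>t A + \<partial>\<^sub>x B = 0\<close> with flux \<open>B = \<Sum>\<^sub>\<alpha> \<integral> v\<^sub>1 f\<^sub>\<alpha> dv\<close>. So the total energy \<open>H\<close> is constant, and
  the energy ahead of a light ray \<open>x = c + s t\<close>, \<open>s = \<plusminus>1\<close>, decreases at the rate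
  \<open>A - s B \<ge> E\<^sub>1\<^sup>2 / 2\<close>. By Cauchy-Schwarz, the time integral of \<open>\<bar>E\<^sub>1\<bar>\<close> along a ray is therefore
  \<open>O(sqrt T)\<close>. A particle with \<open>s v\<^sub>1\<close> between \<open>Q / 2\<close> and \<open>Q\<close> stays within distance \<open>O(T / Q\<^sup>2)\<close>
  of a ray, and the charge in between is \<open>O(Q)\<close> times the integral of \<open>A - s B\<close>, so that replacing
  the particle by the ray costs \<open>O(T / Q)\<close>. Hence \<open>Q / 4 \<le> O(sqrt T) + O(T / Q)\<close>, that is,
  \<open>Q = O(sqrt T)\<close>.
\<close>

subsection \<open>Ordinary differential equations with Lipschitz right-hand sides\<close>

text \<open>The scaling rests on one identity: with \<open>\<gamma>\<close> the particle energy,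
  \<open>(\<gamma> - s v1) (\<gamma> + s v1) = 1 + v2^2\<close>. Hence a particle with
  \<open>s v1\<close> at most \<open>Q\<close> has \<open>\<gamma> - s v1\<close> at least of order
  \<open>1 / Q\<close>, so number density is at most \<open>O(Q)\<close> times
  \<open>A - s B\<close>. The same identity makes the speed deficit at momentum about
  \<open>Q\<close> of order \<open>1 / Q^2\<close>, which gives the width of the strip between
  particle and ray. Each parallel ray in the strip loses at most \<open>H\<close>, so the strip
  costs \<open>Q\<close> times \<open>T / Q^2\<close> times \<open>H\<close>. The force has no
  \<open>v2\<close> component, so \<open>v2\<close> stays in its initial range and the constants
  involve only the data and the charges. To close: where \<open>Q\<close> exceeds
  \<open>sqrt T\<close>, the term \<open>T / Q\<close> is at most \<open>sqrt T\<close>. A separate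
  obstacle comes before all this. Supports are compact at each single time, with no uniformity over
  time intervals, while differentiation under the integral and the conservation laws need it. The
  Baire argument supplies it. The radius \<open>n\<close> so obtained is qualitative and enters no
  final constant.\<close>

lemma continuous_on_superposition:
  assumes "continuous_on ({a..b::real} \<times> UNIV) (\<lambda>(t, y). G t y)" and "continuous_on {a..b} u"
  shows "continuous_on {a..b} (\<lambda>t. G t (u t))"
proof -
  have "continuous_on {a..b} (\<lambda>t. (\<lambda>(t, y). G t y) (t, u t))"
    by (rule continuous_on_compose2[OF assms(1)]) (auto intro!: continuous_intros assms(2))
  then show ?thesis by simp
qed

text \<open>
  The weight \<open>exp (- \<lambda> t)\<close> makes the Picard operator a contraction on the whole interval, so that
  no gluing of local solutions is needed.
\<close>
lemma picard_forward:
  fixes G :: "real \<Rightarrow> 'a::euclidean_space \<Rightarrow> 'a"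
  assumes "a \<le> b"
    and G: "continuous_on ({a..b} \<times> UNIV) (\<lambda>(t, y). G t y)"
    and lip: "\<And>t y z. t \<in> {a..b} \<Longrightarrow> norm (G t y - G t z) \<le> L * norm (y - z)"
  shows "\<exists>y. y a = y0 \<and> (\<forall>t\<in>{a..b}. (y has_vector_derivative G t (y t)) (at t within {a..b}))"
proof -
  define M where "M = \<bar>L\<bar>"
  \<comment> \<open>With \<open>l\<close> at least \<open>2 * M\<close>, the Lipschitz factor
    \<open>M / l\<close> of the operator below is at most \<open>1/2\<close>.\<close>
  define l where "l = 2 * M + 1"
  have M: "0 \<le> M" "l > 0" "2 * M \<le> l" by (auto simp: l_def M_def)
  have lipM: "norm (G t y - G t z) \<le> M * norm (y - z)" if "t \<in> {a..b}" for t y z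
    using lip[OF that, of y z] mult_right_mono[OF abs_ge_self[of L], of "norm (y - z)"] by (simp add: M_def)
  \<comment> \<open>The Picard operator in the unknown \<open>u t = exp (- (l * t)) y t\<close>: the
    plain sup norm of \<open>u\<close> is the weighted norm of \<open>y\<close>.\<close>
  define J where "J u t = exp (- (l * t)) *\<^sub>R (y0 + integral {a..t} (\<lambda>s. G s (exp (l * s) *\<^sub>R apply_bcontfun u s)))"
    for u :: "real \<Rightarrow>\<^sub>C 'a" and t
  have contu: "continuous_on S (apply_bcontfun u)" for u :: "real \<Rightarrow>\<^sub>C 'a" and S
    using apply_bcontfun[of u] by (auto simp: bcontfun_def intro: continuous_on_subset)
  have cint: "continuous_on {a..b} (\<lambda>s. G s (exp (l * s) *\<^sub>R apply_bcontfun u s))" for u :: "real \<Rightarrow>\<^sub>C 'a"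
    by (intro continuous_on_superposition[OF G] continuous_intros contu)
  have contJ: "continuous_on (cbox a b) (J u)" for u
    unfolding J_def cbox_interval
    by (intro continuous_intros indefinite_integral_continuous_1 integrable_continuous_real cint)
  \<comment> \<open>\<open>ext_cont\<close> clamps the argument to the interval, because the fixed
    point theorem is applied to the complete type of bounded continuous functions on the whole
    line.\<close>
  define P where "P u = Bcontfun (ext_cont (J u) a b)" for u
  have P: "apply_bcontfun (P u) = ext_cont (J u) a b" for u
    unfolding P_def
  proof (rule Bcontfun_inverse)
    have "bounded (J u ` cbox a b)"
      by (intro compact_imp_bounded compact_continuous_image contJ compact_cbox)
    then show "ext_cont (J u) a b \<in> bcontfun"
      using clamp_bounded[of "J u" a b] continuous_on_ext_cont[OF contJ]
      by (auto simp: bcontfun_def ext_cont_def)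
  qed
  have "dist (P u) (P w) \<le> 1/2 * dist u w" for u w
  proof (rule dist_bound)
    fix r
    define t where "t = clamp a b r"
    have t: "t \<in> {a..b}" using clamp_in_interval[of a b r] \<open>a \<le> b\<close> by (auto simp: t_def)
    have sub: "{a..t} \<subseteq> {a..b}" using t by auto
    let ?u = "\<lambda>s. G s (exp (l * s) *\<^sub>R apply_bcontfun u s)"
    let ?w = "\<lambda>s. G s (exp (l * s) *\<^sub>R apply_bcontfun w s)"
    have iu: "?u integrable_on {a..t}" and iw: "?w integrable_on {a..t}"
      by (intro integrable_continuous_real continuous_on_subset[OF cint sub])+
    have "((\<lambda>s. M * dist u w * exp (l * s)) has_integral
        (M * dist u w * exp (l * t) / l - M * dist u w * exp (l * a) / l)) {a..t}"
      using t M by (intro fundamental_theorem_of_calculus)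
        (auto intro!: derivative_eq_intros simp flip: has_real_derivative_iff_has_vector_derivative)
    note ex = this
    have "norm (integral {a..t} (\<lambda>s. ?u s - ?w s)) \<le> integral {a..t} (\<lambda>s. M * dist u w * exp (l * s))"
    proof (rule integral_norm_bound_integral)
      fix s assume s: "s \<in> {a..t}"
      have "norm (?u s - ?w s) \<le> M * norm (exp (l * s) *\<^sub>R apply_bcontfun u s - exp (l * s) *\<^sub>R apply_bcontfun w s)"
        using s sub by (intro lipM) auto
      also have "\<dots> = M * (exp (l * s) * dist (apply_bcontfun u s) (apply_bcontfun w s))"
        by (simp add: dist_norm flip: scaleR_diff_right)
      also have "\<dots> \<le> M * (exp (l * s) * dist u w)"
        by (intro mult_left_mono dist_bounded) (use M in auto)
      finally show "norm (?u s - ?w s) \<le> M * dist u w * exp (l * s)" by (simp add: mult_ac)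
    qed (use iu iw ex in \<open>auto intro: integrable_diff\<close>)
    also have "\<dots> \<le> M * dist u w * exp (l * t) / l"
      using integral_unique[OF ex] M by simp
    also have "\<dots> \<le> exp (l * t) * (1/2 * dist u w)"
      using M mult_right_mono[of "2 * M" l "dist u w * exp (l * t)"] by (simp add: field_simps)
    finally have *: "norm (integral {a..t} ?u - integral {a..t} ?w) \<le> exp (l * t) * (1/2 * dist u w)"
      using integral_diff[OF iu iw] by simp
    have "dist (J u t) (J w t) = exp (- (l * t)) * norm (integral {a..t} ?u - integral {a..t} ?w)"
      by (simp add: J_def dist_norm flip: scaleR_diff_right)
    also have "\<dots> \<le> exp (- (l * t)) * (exp (l * t) * (1/2 * dist u w))"
      by (intro mult_left_mono *) auto
    also have "\<dots> = 1/2 * dist u w" by (simp add: exp_minus field_simps)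
    finally show "dist (apply_bcontfun (P u) r) (apply_bcontfun (P w) r) \<le> 1/2 * dist u w"
      by (simp add: P ext_cont_def t_def)
  qed
  then obtain u where u: "P u = u" using banach_fix_type[of "1/2" P] by auto
  define y where "y t = exp (l * t) *\<^sub>R apply_bcontfun u t" for t
  have yt: "y t = y0 + integral {a..t} (\<lambda>s. G s (y s))" if "t \<in> {a..b}" for t
  proof -
    have "apply_bcontfun u t = J u t" using P[of u] u that by simp
    then show ?thesis by (simp add: y_def J_def flip: exp_add)
  qed
  have "(y has_vector_derivative G t (y t)) (at t within {a..b})" if t: "t \<in> {a..b}" for t
  proof (rule has_vector_derivative_transform[OF t yt])
    have "((\<lambda>t. integral {a..t} (\<lambda>s. G s (y s))) has_vector_derivative G t (y t)) (at t within {a..b})"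
      using integral_has_vector_derivative[OF cint[of u] t] by (simp add: y_def)
    then show "((\<lambda>t. y0 + integral {a..t} (\<lambda>s. G s (y s))) has_vector_derivative G t (y t)) (at t within {a..b})"
      by (auto intro!: derivative_eq_intros)
  qed
  moreover have "y a = y0" using yt[of a] \<open>a \<le> b\<close> by simp
  ultimately show ?thesis by blast
qed

text \<open>Time reversal. Characteristics are also needed backwards, to trace a point of the
  support at the final time to earlier times.\<close>

lemma picard_backward:
  fixes G :: "real \<Rightarrow> 'a::euclidean_space \<Rightarrow> 'a"
  assumes "a \<le> b"
    and G: "continuous_on ({a..b} \<times> UNIV) (\<lambda>(t, y). G t y)"
    and lip: "\<And>t y z. t \<in> {a..b} \<Longrightarrow> norm (G t y - G t z) \<le> L * norm (y - z)"
  shows "\<exists>y. y b = y0 \<and> (\<forall>t\<in>{a..b}. (y has_vector_derivative G t (y t)) (at t within {a..b}))"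
proof -
  have "\<exists>y. y (- b) = y0 \<and>
    (\<forall>t\<in>{-b..-a}. (y has_vector_derivative - G (- t) (y t)) (at t within {-b..-a}))"
  proof (rule picard_forward)
    have "continuous_on ({-b..-a} \<times> UNIV) (\<lambda>z. (\<lambda>(t, y). G t y) (- fst z, snd z))"
      by (rule continuous_on_compose2[OF G]) (auto intro!: continuous_intros)
    then show "continuous_on ({-b..-a} \<times> UNIV) (\<lambda>(t, y). - G (- t) y)"
      by (auto simp: case_prod_unfold intro!: continuous_intros)
    show "norm (- G (- t) y - - G (- t) z) \<le> L * norm (y - z)" if "t \<in> {-b..-a}" for t y z
      using lip[of "-t" z y] that by (simp add: norm_minus_commute)
  qed (use \<open>a \<le> b\<close> in auto)
  then obtain y where y: "y (- b) = y0"
    "\<And>t. t\<in>{-b..-a} \<Longrightarrow> (y has_vector_derivative - G (- t) (y t)) (at t within {-b..-a})" by blast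
  have im: "uminus ` {a..b} = {-b..-a}" by auto
  have "((y \<circ> uminus) has_vector_derivative (-1) *\<^sub>R (- G (- (- t)) (y (- t)))) (at t within {a..b})"
    if "t \<in> {a..b}" for t
    by (rule vector_diff_chain_within) (use y(2)[of "-t"] that im in \<open>auto intro!: derivative_eq_intros\<close>)
  then show ?thesis using y(1) by (intro exI[of _ "y \<circ> uminus"]) auto
qed

subsection \<open>A consequence of the Baire property\<close>

text \<open>Otherwise every \<open>F - S n\<close> would be relatively open and dense in
  \<open>F\<close>. By Baire their intersection would be dense in \<open>F\<close>, but the covering
  makes it empty.\<close>

lemma Baire_closed_cover:
  fixes F :: "'a::{real_normed_vector,heine_borel} set" and S :: "nat \<Rightarrow> 'a set"
  assumes "closed F" "F \<noteq> {}" "\<And>n. closed (S n)" "F \<subseteq> (\<Union>n. S n)"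
  shows "\<exists>n. \<exists>p\<in>F. \<exists>\<epsilon>>0. F \<inter> ball p \<epsilon> \<subseteq> S n"
proof (rule ccontr)
  assume contra: "\<not> ?thesis"
  have "F \<subseteq> closure (\<Inter> (range (\<lambda>n. F - S n)))"
  proof (rule Baire)
    fix T assume "T \<in> range (\<lambda>n. F - S n)"
    then obtain n where T: "T = F - S n" by auto
    have "openin (top_of_set F) (F \<inter> (- S n))"
      using assms(3)[of n] by (intro openin_open_Int) auto
    moreover have "F \<subseteq> closure T"
    proof
      fix p assume p: "p \<in> F"
      show "p \<in> closure T"
        unfolding closure_approachable
      proof safe
        fix \<epsilon> :: real assume "\<epsilon> > 0"
        then obtain z where "z \<in> F \<inter> ball p \<epsilon>" "z \<notin> S n" using contra p by blast
        then show "\<exists>y\<in>T. dist y p < \<epsilon>" by (auto simp: T dist_commute)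
      qed
    qed
    ultimately show "openin (top_of_set F) T \<and> F \<subseteq> closure T"
      by (simp add: T Diff_eq)
  qed (use assms in auto)
  moreover have "\<Inter> (range (\<lambda>n. F - S n)) = {}" using assms(4) by auto
  ultimately show False using assms(2) by (metis closure_empty subset_empty)
qed

subsection \<open>Integrals of compactly supported functions\<close>

lemma has_derivative_along:
  assumes "(F has_derivative F') (at (c s) within S)" "(c has_vector_derivative u) (at s within T)" "c ` T \<subseteq> S"
  shows "((\<lambda>s. F (c s)) has_vector_derivative F' u) (at s within T)"
proof -
  have "((\<lambda>s. F (c s)) has_derivative (\<lambda>h. F' (h *\<^sub>R u))) (at s within T)"
    using assms(2) unfolding has_vector_derivative_def
    by (rule has_derivative_in_compose) (rule has_derivative_subset[OF assms(1,3)])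
  then show ?thesis
    using has_derivative_bounded_linear[OF assms(1)] by (simp add: has_vector_derivative_def linear_simps)
qed

definition cumul :: "(real \<Rightarrow> real) \<Rightarrow> real \<Rightarrow> real" where
  "cumul A x = integral {..x} A"

locale supported =
  fixes A :: "real \<Rightarrow> real" and n :: real
  assumes cont: "continuous_on UNIV A" and outside: "\<And>x. n < \<bar>x\<bar> \<Longrightarrow> A x = 0" and n: "0 \<le> n"
begin

lemma integrable_Icc: "A integrable_on {x..y}"
  by (intro integrable_continuous_real continuous_on_subset[OF cont]) auto

lemma has_integral_cumul:
  assumes "n \<le> M" shows "(A has_integral integral {-M..x} A) {..x}"
proof -
  have "(A has_integral integral {-M..x} A) {-M..x}"
    by (intro integrable_integral integrable_Icc)
  then show ?thesis
    using assms outside by (subst has_integral_spike_set_eq[where T = "{-M..x}"])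
      (auto intro!: empty_imp_negligible simp: not_le)
qed

lemma cumul_eq: "n \<le> M \<Longrightarrow> cumul A x = integral {-M..x} A"
  unfolding cumul_def by (intro integral_unique has_integral_cumul)

lemma cumul_const: assumes "n \<le> x" shows "cumul A x = cumul A n"
proof -
  have "integral {-n..n} A + integral {n..x} A = integral {-n..x} A"
    using assms n by (intro Henstock_Kurzweil_Integration.integral_combine integrable_Icc) auto
  \<comment> \<open>The assumption \<open>outside\<close> is silent at the end point
    \<open>n\<close>, hence the exceptional set.\<close>
  moreover have "integral {n..x} A = integral {n..x} (\<lambda>x. 0)"
    using outside by (intro integral_spike[of "{n}"]) auto
  ultimately show ?thesis by (simp add: cumul_eq[of n])
qed

lemma cumul_zero: "x < -n \<Longrightarrow> cumul A x = 0"
  by (simp add: cumul_eq[of n])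

lemma has_integral_UNIV: "(A has_integral cumul A n) UNIV"
proof -
  have "(A has_integral cumul A n) {-n..n}"
    by (simp add: cumul_eq[of n] integrable_Icc integrable_integral)
  then show ?thesis by (rule has_integral_on_superset) (use outside in auto)
qed

lemma integrable_lborel: "integrable lborel A"
proof -
  have "integrable lborel (\<lambda>x. indicator {-n..n} x *\<^sub>R A x)"
    by (intro borel_integrable_compact continuous_on_subset[OF cont]) auto
  moreover have "(\<lambda>x. indicator {-n..n} x *\<^sub>R A x) = A"
    using outside by (force simp: indicator_def)
  ultimately show ?thesis by simp
qed

lemma lborel_integral: "(LINT x|lborel. A x) = cumul A n"
  using has_integral_UNIV by (simp add: integral_lborel[OF integrable_lborel, symmetric] integral_unique)

lemma set_integrable_lborel: "S \<in> sets borel \<Longrightarrow> set_integrable lborel S A"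
  unfolding set_integrable_def by (intro integrable_mult_indicator integrable_lborel) auto

lemma set_lborel_integral_atMost: "(LINT x:{..x}|lborel. A x) = cumul A x"
  by (simp add: set_borel_integral_eq_integral set_integrable_lborel cumul_def)

lemma set_lborel_integral_atLeast: "(LINT x:{x..}|lborel. A x) = cumul A n - cumul A x"
proof -
  have "(LINT x:{..<x} \<union> {x..}|lborel. A x) = (LINT x:{..<x}|lborel. A x) + (LINT x:{x..}|lborel. A x)"
    by (intro set_integral_Un set_integrable_lborel) auto
  moreover have "{..<x} \<union> {x..} = UNIV" by auto
  moreover have "(LINT x:{..<x}|lborel. A x) = (LINT x:{..x}|lborel. A x)"
  proof -
    have "integral {..<x} A = integral {..x} A"
      by (intro integral_spike_set) (auto intro: negligible_subset[of "{x}"])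
    then show ?thesis by (simp add: set_borel_integral_eq_integral set_integrable_lborel)
  qed
  moreover have "(LINT x:UNIV|lborel. A x) = cumul A n"
    using lborel_integral by (simp add: set_lebesgue_integral_def)
  ultimately show ?thesis by (simp add: set_lborel_integral_atMost)
qed

lemma cumul_has_derivative: "(cumul A has_real_derivative A x) (at x)"
proof -
  define M where "M = max n \<bar>x\<bar> + 1"
  have "((\<lambda>x. integral {-M..x} A) has_vector_derivative A x) (at x within {-M..M})"
    by (intro integral_has_vector_derivative continuous_on_subset[OF cont]) (auto simp: M_def)
  then have "((\<lambda>x. integral {-M..x} A) has_real_derivative A x) (at x)"
    by (subst (asm) at_within_Icc_at) (auto simp: M_def has_real_derivative_iff_has_vector_derivative)
  moreover have "cumul A = (\<lambda>x. integral {-M..x} A)"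
    by (intro ext cumul_eq) (auto simp: M_def)
  ultimately show ?thesis by simp
qed

lemma cumul_diff: assumes "x \<le> y" shows "cumul A y - cumul A x = integral {x..y} A"
proof -
  have "(A has_integral (cumul A y - cumul A x)) {x..y}"
    using assms cumul_has_derivative by (intro fundamental_theorem_of_calculus)
      (auto simp flip: has_real_derivative_iff_has_vector_derivative intro: DERIV_subset)
  then show ?thesis by (simp add: integral_unique)
qed

lemma cumul_mono:
  assumes "\<And>x. 0 \<le> A x" "x \<le> y" shows "cumul A x \<le> cumul A y"
proof -
  have "0 \<le> integral {x..y} A" by (intro integral_nonneg integrable_Icc) (use assms in auto)
  then show ?thesis using cumul_diff[OF assms(2)] by simp
qed

lemma cumul_bounds:
  assumes "\<And>x. 0 \<le> A x" shows "0 \<le> cumul A x" "cumul A x \<le> cumul A n"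
proof -
  have "cumul A (min x (-n-1)) \<le> cumul A x" by (intro cumul_mono assms) auto
  then show "0 \<le> cumul A x" using cumul_zero[of "min x (-n-1)"] by simp
  have "cumul A x \<le> cumul A (max x n)" by (intro cumul_mono assms) auto
  then show "cumul A x \<le> cumul A n" using cumul_const[of "max x n"] by simp
qed

end

lemma cumul_abs_le:
  assumes "supported A n" "supported B n" "\<And>x. \<bar>A x\<bar> \<le> B x"
  shows "\<bar>cumul A x\<bar> \<le> cumul B x"
proof -
  have "norm (integral {-n..x} A) \<le> integral {-n..x} B"
    by (intro integral_norm_bound_integral) (use assms in \<open>auto intro: supported.integrable_Icc\<close>)
  then show ?thesis
    using supported.cumul_eq[OF assms(1) order_refl] supported.cumul_eq[OF assms(2) order_refl] by simp
qed

text \<open>The law \<open>A_t + B_x = 0\<close>, encoded by the same \<open>At\<close> in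
  \<open>deriv_A\<close> and \<open>deriv_B\<close>. It is instantiated for charge, particle number
  and energy. Continuity of \<open>At\<close> allows differentiation under the integral; time
  derivatives are one-sided at \<open>a\<close> and \<open>b\<close>.\<close>

locale conservation_law =
  fixes A At B :: "real \<Rightarrow> real \<Rightarrow> real" and a b n :: real
  assumes ab: "a \<le> b"
    and cont_A: "continuous_on ({a..b} \<times> UNIV) (\<lambda>(t, x). A t x)"
    and deriv_A: "\<And>t x. t \<in> {a..b} \<Longrightarrow> ((\<lambda>t. A t x) has_real_derivative At t x) (at t within {a..b})"
    and cont_At: "continuous_on ({a..b} \<times> UNIV) (\<lambda>(t, x). At t x)"
    and deriv_B: "\<And>t x. t \<in> {a..b} \<Longrightarrow> (B t has_real_derivative - At t x) (at x)"
    and A_outside: "\<And>t x. t \<in> {a..b} \<Longrightarrow> n < \<bar>x\<bar> \<Longrightarrow> A t x = 0"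
    and B_outside: "\<And>t x. t \<in> {a..b} \<Longrightarrow> n < \<bar>x\<bar> \<Longrightarrow> B t x = 0"
    and n0: "0 \<le> n"
begin

lemma cont_slice:
  assumes "t \<in> {a..b}" shows "continuous_on S (A t)"
proof -
  have "continuous_on S (\<lambda>x. (\<lambda>(t, x). A t x) (t, x))"
    by (rule continuous_on_compose2[OF cont_A]) (use assms in \<open>auto intro!: continuous_intros\<close>)
  then show ?thesis by simp
qed

lemma supported_slice: "t \<in> {a..b} \<Longrightarrow> supported (A t) n"
  using A_outside n0 cont_slice by unfold_locales auto

lemma cumul_time_derivative:
  assumes t: "t \<in> {a..b}"
  shows "((\<lambda>t. cumul (A t) x) has_real_derivative - B t x) (at t within {a..b})"
proof -
  define M where "M = max n \<bar>x\<bar> + 1"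
  have "((\<lambda>t. integral (cbox (-M) x) (A t)) has_real_derivative integral (cbox (-M) x) (At t)) (at t within {a..b})"
    by (intro leibniz_rule_field_derivative continuous_on_subset[OF cont_At] integrable_continuous_real t deriv_A)
       (auto intro!: cont_slice integrable_continuous_real)
  moreover have "integral {-M..x} (At t) = - B t x"
  proof -
    have "((\<lambda>x. At t x) has_integral (- B t x - - B t (-M))) {-M..x}"
    proof (rule fundamental_theorem_of_calculus)
      fix y
      have "((\<lambda>y. - B t y) has_real_derivative At t y) (at y within {-M..x})"
        using DERIV_minus[OF deriv_B[OF t, of y]] by (auto intro: DERIV_subset)
      then show "((\<lambda>y. - B t y) has_vector_derivative At t y) (at y within {-M..x})"
        by (simp add: has_real_derivative_iff_has_vector_derivative)
    qed (auto simp: M_def)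
    moreover have "B t (-M) = 0" by (intro B_outside t) (auto simp: M_def)
    ultimately show ?thesis by (simp add: integral_unique)
  qed
  moreover have "cumul (A s) x = integral {-M..x} (A s)" if "s \<in> {a..b}" for s
    using supported_slice[OF that] by (intro supported.cumul_eq[of _ n]) (auto simp: M_def)
  ultimately show ?thesis
    using t by (auto intro: has_field_derivative_transform_within[where d = 1])
qed

text \<open>Two partial derivatives give total differentiability here because the spatial one,
  \<open>A\<close>, is jointly continuous. This is what permits differentiation along the moving
  points in \<open>cumul_along\<close>.\<close>

lemma cumul_joint_derivative:
  assumes t: "t \<in> {a..b}"
  shows "((\<lambda>(t, x). cumul (A t) x) has_derivative (\<lambda>(dt, dx). - B t x * dt + A t x * dx))
           (at (t, x) within {a..b} \<times> UNIV)"
proof -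
  have "((\<lambda>(t, x). cumul (A t) x) has_derivative
      (\<lambda>(dt, dx). - B t x * dt + blinfun_apply (blinfun_mult_right (A t x)) dx)) (at (t, x) within {a..b} \<times> UNIV)"
  proof (rule has_derivative_partialsI)
    show "((\<lambda>t. cumul (A t) x) has_derivative (\<lambda>dt. - B t x * dt)) (at t within {a..b})"
      using cumul_time_derivative[OF t] unfolding has_field_derivative_def .
    show "((\<lambda>x. cumul (A t) x) has_derivative blinfun_apply (blinfun_mult_right (A t x))) (at x within UNIV)"
      if "t \<in> {a..b}" for t x
      using supported.cumul_has_derivative[OF supported_slice[OF that], of x]
      by (simp add: has_field_derivative_def mult.commute)
    have "continuous_on ({a..b} \<times> UNIV) (\<lambda>z. blinfun_mult_right ((\<lambda>(t, x). A t x) z))"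
      by (intro bounded_linear.continuous_on[OF bounded_linear_blinfun_mult_right] cont_A)
    then show "continuous (at (t, x) within {a..b} \<times> UNIV) (\<lambda>(t, x). blinfun_mult_right (A t x))"
      using t by (simp add: continuous_on_eq_continuous_within case_prod_unfold)
  qed auto
  then show ?thesis by simp
qed

lemma cumul_along:
  assumes t: "t \<in> {a..b}"
  shows "((\<lambda>t. cumul (A t) (c + s * t)) has_real_derivative s * A t (c + s * t) - B t (c + s * t)) (at t within {a..b})"
proof -
  have "((\<lambda>t. (t, c + s * t)) has_vector_derivative (1, s)) (at t within {a..b})"
    by (auto intro!: derivative_eq_intros simp: has_vector_derivative_def)
  from has_derivative_along[OF cumul_joint_derivative[OF t, of "c + s * t"] this]
  have "((\<lambda>t. cumul (A t) (c + s * t)) has_vector_derivative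
      - B t (c + s * t) + A t (c + s * t) * s) (at t within {a..b})" by auto
  then show ?thesis by (simp add: has_real_derivative_iff_has_vector_derivative mult.commute)
qed

lemma cumul_continuous: "continuous_on ({a..b} \<times> UNIV) (\<lambda>(t, x). cumul (A t) x)"
  unfolding continuous_on_eq_continuous_within
  using cumul_joint_derivative has_derivative_continuous by fast

lemma total_constant:
  assumes "t \<in> {a..b}" "s \<in> {a..b}"
  shows "cumul (A t) n = cumul (A s) n"
proof -
  \<comment> \<open>The point \<open>n + 1\<close> replaces \<open>n\<close> because
    \<open>B_outside\<close> is silent at \<open>n\<close> itself.\<close>
  have "((\<lambda>t. cumul (A t) (n + 1)) has_real_derivative 0) (at t within {a..b})" if "t \<in> {a..b}" for t
    using cumul_time_derivative[OF that, of "n + 1"] B_outside[OF that, of "n + 1"] n0 by simp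
  then have "\<exists>c. \<forall>t\<in>{a..b}. cumul (A t) (n + 1) = c"
    by (intro has_field_derivative_zero_constant) auto
  moreover have "cumul (A t) (n + 1) = cumul (A t) n" if "t \<in> {a..b}" for t
    using supported.cumul_const[OF supported_slice[OF that], of "n + 1"] by simp
  ultimately show ?thesis using assms by metis
qed

end

subsection \<open>Velocity moments\<close>

definition mom :: "(real \<times> real \<Rightarrow> real) \<Rightarrow> (real \<times> real \<Rightarrow> real) \<Rightarrow> real" where
  "mom w g = integral UNIV (\<lambda>v. w v * g v)"

text \<open>The margin 1 makes a density supported in \<open>norm v \<le> n\<close> vanish on the
  faces of the box, as integration by parts in \<open>v1\<close> requires.\<close>

abbreviation vbox :: "real \<Rightarrow> (real \<times> real) set" where
  "vbox n \<equiv> cbox (-(n + 1), -(n + 1)) (n + 1, n + 1)"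

lemma mem_vbox: "norm v \<le> n \<Longrightarrow> v \<in> vbox n"
  using norm_fst_le[of "fst v" "snd v"] norm_snd_le[of "snd v" "fst v"]
  by (cases v) (auto simp: cbox_Pair_eq)

locale phase_slice =
  fixes g :: "real \<times> real \<Rightarrow> real" and n :: real
  assumes cont: "continuous_on UNIV g" and outside: "\<And>v. n < norm v \<Longrightarrow> g v = 0"
begin

lemma zero_off_vbox: "v \<notin> vbox n \<Longrightarrow> g v = 0"
  using mem_vbox[of v n] outside[of v] by force

lemma has_integral_mom:
  assumes "continuous_on UNIV w"
  shows "((\<lambda>v. w v * g v) has_integral integral (vbox n) (\<lambda>v. w v * g v)) UNIV"
proof (rule has_integral_on_superset[OF integrable_integral])
  show "(\<lambda>v. w v * g v) integrable_on vbox n"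
    by (intro integrable_continuous continuous_intros continuous_on_subset[OF assms] continuous_on_subset[OF cont]) auto
qed (auto simp: zero_off_vbox)

lemma mom_eq: "continuous_on UNIV w \<Longrightarrow> mom w g = integral (vbox n) (\<lambda>v. w v * g v)"
  unfolding mom_def by (intro integral_unique has_integral_mom)

lemma integrable_mom: "continuous_on UNIV w \<Longrightarrow> (\<lambda>v. w v * g v) integrable_on UNIV"
  using has_integral_mom by blast

lemma integrable_lborel: "integrable lborel g"
proof -
  have "integrable lborel (\<lambda>v. indicator (vbox n) v *\<^sub>R g v)"
    by (intro borel_integrable_compact continuous_on_subset[OF cont]) auto
  moreover have "(\<lambda>v. indicator (vbox n) v *\<^sub>R g v) = g"
    using zero_off_vbox by (force simp: indicator_def)
  ultimately show ?thesis by simp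
qed

lemma lborel_integral: "(LINT v|lborel. g v) = mom (\<lambda>_. 1) g"
  by (simp add: mom_def integral_lborel[OF integrable_lborel])

end

text \<open>One species under a given force \<open>F\<close>. The Vlasov equation appears as a
  vanishing directional derivative; the final 0 of the direction expresses that \<open>v2\<close>
  does not change along characteristics.\<close>

locale kinetic =
  fixes g :: "real \<Rightarrow> real \<Rightarrow> real \<times> real \<Rightarrow> real"
    and D :: "real \<times> real \<times> real \<times> real \<Rightarrow> ((real \<times> real \<times> real \<times> real) \<Rightarrow>\<^sub>L real)"
    and F :: "real \<Rightarrow> real \<Rightarrow> real" and a b n :: real
  assumes ab: "0 \<le> a" "a \<le> b" and n: "0 \<le> n"
    and deriv: "\<And>z. z \<in> {0..} \<times> UNIV \<Longrightarrow>
        ((\<lambda>(t, x, v). g t x v) has_derivative blinfun_apply (D z)) (at z within {0..} \<times> UNIV)"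
    and cont_D: "continuous_on ({0..} \<times> UNIV) D"
    and supp: "\<And>t x v. t \<in> {a..b} \<Longrightarrow> g t x v \<noteq> 0 \<Longrightarrow> \<bar>x\<bar> \<le> n \<and> norm v \<le> n"
    and transport: "\<And>t x v. t \<in> {a..b} \<Longrightarrow>
        blinfun_apply (D (t, x, v)) (1, fst (vhat v), F t x, 0) = 0"
begin

lemma cont_g: "continuous_on ({0..} \<times> UNIV) (\<lambda>(t, x, v). g t x v)"
  unfolding continuous_on_eq_continuous_within using deriv has_derivative_continuous by blast

lemma cont_g_comp:
  assumes "continuous_on S p" "continuous_on S q" "continuous_on S r" "\<And>s. s \<in> S \<Longrightarrow> 0 \<le> p s"
  shows "continuous_on S (\<lambda>s. g (p s) (q s) (r s))"
proof -
  have "continuous_on S (\<lambda>s. (\<lambda>(t, x, v). g t x v) (p s, q s, r s))"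
    by (rule continuous_on_compose2[OF cont_g]) (use assms in \<open>auto intro!: continuous_intros\<close>)
  then show ?thesis by simp
qed

lemma cont_D_comp:
  assumes "continuous_on S p" "\<And>s. s \<in> S \<Longrightarrow> 0 \<le> fst (p s)"
  shows "continuous_on S (\<lambda>s. D (p s))"
proof (rule continuous_on_compose2[OF cont_D assms(1)])
  show "p ` S \<subseteq> {0..} \<times> UNIV"
    using assms(2) by (simp add: image_subset_iff mem_Times_iff)
qed

lemma deriv_along:
  assumes "(p has_real_derivative p') (at s within T)" "(q has_real_derivative q') (at s within T)"
    "(r has_vector_derivative r') (at s within T)" "\<And>s. s \<in> T \<Longrightarrow> 0 \<le> p s" "s \<in> T"
  shows "((\<lambda>s. g (p s) (q s) (r s)) has_real_derivative blinfun_apply (D (p s, q s, r s)) (p', q', r')) (at s within T)"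
proof -
  have "((\<lambda>s. (p s, q s, r s)) has_vector_derivative (p', q', r')) (at s within T)"
    using assms(1-3) by (auto intro!: derivative_eq_intros has_vector_derivative_Pair
      simp: has_real_derivative_iff_has_vector_derivative)
  from has_derivative_along[OF deriv this] show ?thesis
    using assms(4,5) by (auto simp: has_real_derivative_iff_has_vector_derivative)
qed

lemma slice: assumes "t \<in> {a..b}" shows "phase_slice (g t x) n"
  by unfold_locales (use assms ab supp[of t x] in \<open>force intro!: cont_g_comp\<close>)+

lemma mom_outside: "t \<in> {a..b} \<Longrightarrow> n < \<bar>x\<bar> \<Longrightarrow> mom w (g t x) = 0"
proof -
  assume "t \<in> {a..b}" "n < \<bar>x\<bar>"
  then have "g t x v = 0" for v using supp[of t x v] by force
  then show ?thesis by (simp add: mom_def)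
qed

context
  fixes w :: "real \<times> real \<Rightarrow> real" assumes w: "continuous_on UNIV w"
begin

lemma w_comp: "continuous_on S r \<Longrightarrow> continuous_on S (\<lambda>s. w (r s))"
  by (rule continuous_on_compose2[OF w]) auto

lemma mom_continuous: "continuous_on ({a..b} \<times> UNIV) (\<lambda>(t, x). mom w (g t x))"
proof -
  have "continuous_on ({a..b} \<times> UNIV) (\<lambda>z. integral (vbox n) (\<lambda>v. w v * g (fst z) (snd z) v))"
    by (rule integral_continuous_on_param)
       (use ab in \<open>auto simp: case_prod_unfold intro!: continuous_intros cont_g_comp w_comp\<close>)
  then show ?thesis
    by (rule continuous_on_eq) (use phase_slice.mom_eq[OF slice w] in auto)
qed

definition mom_t where
  "mom_t t x = integral (vbox n) (\<lambda>v. w v * blinfun_apply (D (t, x, v)) (1, 0, 0))"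

lemma mom_t_continuous: "continuous_on ({a..b} \<times> UNIV) (\<lambda>(t, x). mom_t t x)"
proof -
  have "continuous_on ({a..b} \<times> UNIV) (\<lambda>z. integral (vbox n)
      (\<lambda>v. w v * blinfun_apply (D (fst z, snd z, v)) (1, 0, 0)))"
    by (rule integral_continuous_on_param)
       (use ab in \<open>auto simp: case_prod_unfold intro!: continuous_intros cont_D_comp w_comp\<close>)
  then show ?thesis by (simp add: mom_t_def case_prod_unfold)
qed

lemma mom_has_time_derivative:
  assumes t: "t \<in> {a..b}"
  shows "((\<lambda>t. mom w (g t x)) has_real_derivative mom_t t x) (at t within {a..b})"
proof -
  have "((\<lambda>t. integral (vbox n) (\<lambda>v. w v * g t x v)) has_real_derivative mom_t t x) (at t within {a..b})"
    unfolding mom_t_def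
  proof (rule leibniz_rule_field_derivative)
    show "((\<lambda>t. w v * g t x v) has_real_derivative w v * blinfun_apply (D (t, x, v)) (1, 0, 0)) (at t within {a..b})"
      if "t \<in> {a..b}" for t v
      by (intro DERIV_cmult deriv_along) (use ab that in \<open>auto intro!: derivative_eq_intros simp: zero_prod_def\<close>)
  qed (use t ab in \<open>auto intro!: integrable_continuous continuous_intros cont_g_comp cont_D_comp w_comp simp: case_prod_unfold\<close>)
  then show ?thesis
    using phase_slice.mom_eq[OF slice w] t
    by (auto intro: has_field_derivative_transform_within[where d = 1])
qed

lemma mom_has_space_derivative:
  assumes t: "t \<in> {a..b}"
  shows "((\<lambda>x. mom w (g t x)) has_real_derivative
      integral (vbox n) (\<lambda>v. w v * blinfun_apply (D (t, x, v)) (0, 1, 0))) (at x)"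
proof -
  have "((\<lambda>x. integral (vbox n) (\<lambda>v. w v * g t x v)) has_real_derivative
      integral (vbox n) (\<lambda>v. w v * blinfun_apply (D (t, x, v)) (0, 1, 0))) (at x within UNIV)"
  proof (rule leibniz_rule_field_derivative)
    show "((\<lambda>x. w v * g t x v) has_real_derivative w v * blinfun_apply (D (t, x, v)) (0, 1, 0)) (at x within UNIV)"
      for x v
      by (intro DERIV_cmult deriv_along) (use ab t in \<open>auto intro!: derivative_eq_intros simp: zero_prod_def\<close>)
  qed (use t ab in \<open>auto intro!: integrable_continuous continuous_intros cont_g_comp cont_D_comp w_comp simp: case_prod_unfold\<close>)
  then show ?thesis using phase_slice.mom_eq[OF slice[OF t] w] by simp
qed

text \<open>The sum \<open>H\<close> of the two integrands is the \<open>v1\<close>-derivative of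
  \<open>w * g\<close>, and \<open>g\<close> vanishes at both ends of the range of
  \<open>v1\<close>.\<close>

lemma mom_by_parts:
  assumes t: "t \<in> {a..b}" and w': "continuous_on UNIV w'"
    and deriv_w: "\<And>v1 v2. ((\<lambda>u. w (u, v2)) has_real_derivative w' (v1, v2)) (at v1)"
  shows "integral (vbox n) (\<lambda>v. w v * blinfun_apply (D (t, x, v)) (0, 0, 1, 0)) = - mom w' (g t x)"
proof -
  define m where "m = n + 1"
  have w'_comp: "continuous_on S r \<Longrightarrow> continuous_on S (\<lambda>s. w' (r s))" for S :: "(real \<times> real) set" and r
    by (rule continuous_on_compose2[OF w']) auto
  define H where "H v = w v * blinfun_apply (D (t, x, v)) (0, 0, 1, 0) + w' v * g t x v" for v
  have cH: "continuous_on S H" for S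
    unfolding H_def by (intro continuous_intros cont_g_comp cont_D_comp w_comp w'_comp) (use t ab in auto)
  have inner: "integral {-m..m} (\<lambda>u. H (u, v2)) = 0" for v2
  proof -
    have "((\<lambda>u. H (u, v2)) has_integral (w (m, v2) * g t x (m, v2) - w (-m, v2) * g t x (-m, v2))) {-m..m}"
    proof (rule fundamental_theorem_of_calculus)
      fix u assume "u \<in> {-m..m}"
      have "((\<lambda>u. g t x (u, v2)) has_real_derivative blinfun_apply (D (t, x, (u, v2))) (0, 0, 1, 0)) (at u within UNIV)"
        by (intro deriv_along) (use ab t in \<open>auto intro!: derivative_eq_intros has_vector_derivative_Pair\<close>)
      from DERIV_mult'[OF deriv_w this]
      have "((\<lambda>u. w (u, v2) * g t x (u, v2)) has_real_derivative H (u, v2)) (at u)"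
        by (simp add: H_def)
      then show "((\<lambda>u. w (u, v2) * g t x (u, v2)) has_vector_derivative H (u, v2)) (at u within {-m..m})"
        by (auto simp flip: has_real_derivative_iff_has_vector_derivative intro: DERIV_subset)
    qed (use n in \<open>simp add: m_def\<close>)
    moreover have "g t x (m, v2) = 0" "g t x (-m, v2) = 0"
      using phase_slice.outside[OF slice[OF t], of "(m, v2)" x] phase_slice.outside[OF slice[OF t], of "(-m, v2)" x]
        norm_fst_le[of m v2] norm_fst_le[of "-m" v2] n by (auto simp: m_def)
    ultimately show ?thesis by (simp add: integral_unique)
  qed
  have "integral (vbox n) H = integral (cbox (-m) m) (\<lambda>u. integral (cbox (-m) m) (\<lambda>v2. H (u, v2)))"
    unfolding m_def by (intro integral_prod_continuous cH)
  \<comment> \<open>The product formula leaves \<open>v1\<close> outside; \<open>inner\<close> needs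
    it inside.\<close>
  also have "\<dots> = integral (cbox (-m) m) (\<lambda>v2. integral (cbox (-m) m) (\<lambda>u. H (u, v2)))"
    by (intro integral_swap_continuous) (use cH in \<open>simp add: case_prod_unfold\<close>)
  also have "\<dots> = 0" by (simp add: inner)
  finally have "integral (vbox n) H = 0" .
  moreover have "integral (vbox n) H =
      integral (vbox n) (\<lambda>v. w v * blinfun_apply (D (t, x, v)) (0, 0, 1, 0)) + integral (vbox n) (\<lambda>v. w' v * g t x v)"
    unfolding H_def
    by (intro Henstock_Kurzweil_Integration.integral_add integrable_continuous continuous_intros
        cont_g_comp cont_D_comp w_comp w'_comp) (use t ab in auto)
  ultimately show ?thesis using phase_slice.mom_eq[OF slice[OF t] w'] by simp
qed

end

lemma cont_vhat: "continuous_on S (\<lambda>v. fst (vhat v))"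
  unfolding vhat_def by (intro continuous_intros) (auto simp: add_nonneg_eq_0_iff)

text \<open>The transport equation times \<open>w\<close>, integrated over \<open>v\<close>. With
  \<open>w = 1\<close> this is the continuity equation; with the particle energy as
  \<open>w\<close>, the term in \<open>w'\<close> is the power of the force.\<close>

lemma mom_transport:
  assumes w: "continuous_on UNIV w" and t: "t \<in> {a..b}" and w': "continuous_on UNIV w'"
    and deriv_w: "\<And>v1 v2. ((\<lambda>u. w (u, v2)) has_real_derivative w' (v1, v2)) (at v1)"
  shows "((\<lambda>x. mom (\<lambda>v. w v * fst (vhat v)) (g t x)) has_real_derivative
      F t x * mom w' (g t x) - mom_t w t x) (at x)"
proof -
  have cw: "continuous_on UNIV (\<lambda>v. w v * fst (vhat v))" by (intro continuous_intros cont_vhat w)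
  let ?D = "\<lambda>v. blinfun_apply (D (t, x, v))"
  have cD: "continuous_on S (\<lambda>v. ?D v d)" for S d
    by (intro blinfun.continuous_on cont_D_comp continuous_intros) (use t ab in auto)
  have "?D v (1, 0, 0) + fst (vhat v) * ?D v (0, 1, 0) + F t x * ?D v (0, 0, 1, 0) = 0" for v
  proof -
    have "?D v ((1, 0, 0) + fst (vhat v) *\<^sub>R (0, 1, 0) + F t x *\<^sub>R (0, 0, 1, 0)) = 0"
      using transport[OF t, of x v] by (simp add: zero_prod_def)
    then show ?thesis by (simp only: blinfun.add_right blinfun.scaleR_right real_scaleR_def)
  qed
  then have eq: "w v * fst (vhat v) * ?D v (0, 1, 0) =
      - (w v * ?D v (1, 0, 0)) - F t x * (w v * ?D v (0, 0, 1, 0))" for v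
    by (smt (verit, best) distrib_left mult.assoc mult.left_commute)
  have "integral (vbox n) (\<lambda>v. w v * fst (vhat v) * ?D v (0, 1, 0)) =
      - integral (vbox n) (\<lambda>v. w v * ?D v (1, 0, 0)) - F t x * integral (vbox n) (\<lambda>v. w v * ?D v (0, 0, 1, 0))"
    unfolding eq
    by (subst integral_diff)
      (auto intro!: integrable_continuous continuous_intros cD continuous_on_subset[OF w])
  then show ?thesis
    using mom_has_space_derivative[OF cw t, of x] mom_by_parts[OF w t w' deriv_w, of x]
    by (simp add: mom_t_def[OF w])
qed

end

subsection \<open>Characteristics\<close>

lemma fst_vhat: "fst (vhat (u, v)) = u / sqrt (1 + u\<^sup>2 + v\<^sup>2)"
  by (simp add: vhat_def norm_Pair add.assoc divide_inverse mult.commute)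

lemma abs_fst_vhat_le: "\<bar>fst (vhat v)\<bar> \<le> 1"
proof -
  have "norm (vhat v) \<le> 1"
    by (auto simp: vhat_def divide_inverse[symmetric] divide_le_eq add_pos_nonneg mult.commute[of "inverse _"]
        intro!: real_le_rsqrt)
  then show ?thesis using norm_fst_le[of "fst (vhat v)" "snd (vhat v)"] by simp
qed

text \<open>Velocity as the momentum derivative of the energy: the reason why the power of the force
  is expressed by the same moment as the current.\<close>

lemma energy_derivative:
  "((\<lambda>u. sqrt (1 + (norm (u, v))\<^sup>2)) has_real_derivative fst (vhat (u, v))) (at u)"
proof -
  have pos: "1 + u\<^sup>2 + v\<^sup>2 > 0" by (simp add: add_pos_nonneg)
  have "((\<lambda>u. 1 + u\<^sup>2 + v\<^sup>2) has_real_derivative 2 * u) (at u)"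
    by (auto intro!: derivative_eq_intros)
  from DERIV_chain2[OF DERIV_real_sqrt[OF pos] this]
  have "((\<lambda>u. sqrt (1 + u\<^sup>2 + v\<^sup>2)) has_real_derivative fst (vhat (u, v))) (at u)"
    by (rule DERIV_cong) (simp add: fst_vhat field_simps)
  then show ?thesis by (simp add: norm_Pair add.assoc)
qed

text \<open>For fixed \<open>v\<close> the derivative in \<open>u\<close> is
  \<open>(1 + v^2) / (1 + u^2 + v^2)^(3/2)\<close>, which is at most 1. Picard iteration needs such
  a global bound.\<close>

lemma fst_vhat_lipschitz: "\<bar>fst (vhat (u, v)) - fst (vhat (w, v))\<bar> \<le> \<bar>u - w\<bar>"
proof -
  have d: "((\<lambda>u. fst (vhat (u, v))) has_real_derivative (1 + v\<^sup>2) / (1 + u\<^sup>2 + v\<^sup>2) / sqrt (1 + u\<^sup>2 + v\<^sup>2)) (at u)" for u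
  proof -
    define r where "r = sqrt (1 + u\<^sup>2 + v\<^sup>2)"
    have pos: "1 + u\<^sup>2 + v\<^sup>2 > 0" by (simp add: add_pos_nonneg)
    then have r: "r > 0" "r * r = 1 + u\<^sup>2 + v\<^sup>2" by (simp_all add: r_def)
    have "((\<lambda>u. sqrt (1 + u\<^sup>2 + v\<^sup>2)) has_real_derivative u / r) (at u)"
      using energy_derivative[of v u] by (simp add: fst_vhat r_def norm_Pair add.assoc)
    from DERIV_quotient[OF DERIV_ident this]
    have "((\<lambda>u. u / sqrt (1 + u\<^sup>2 + v\<^sup>2)) has_real_derivative (1 * r - u / r * u) / r\<^sup>2) (at u)"
      using r by (simp add: r_def)
    moreover have "(1 * r - u / r * u) / r\<^sup>2 = (1 + v\<^sup>2) / (1 + u\<^sup>2 + v\<^sup>2) / r"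
    proof -
      have "1 * r - u / r * u = (r * r - u\<^sup>2) / r"
        using r(1) by (simp add: power2_eq_square diff_divide_distrib)
      then show ?thesis using r by (simp add: power2_eq_square[of r])
    qed
    ultimately show ?thesis by (simp add: fst_vhat r_def)
  qed
  have "norm (fst (vhat (u, v)) - fst (vhat (w, v))) \<le> 1 * norm (u - w)"
  proof (rule field_differentiable_bound[of UNIV])
    fix u
    have q: "0 < 1 + u\<^sup>2 + v\<^sup>2" by (simp add: add_pos_nonneg)
    then have "(1 + v\<^sup>2) / (1 + u\<^sup>2 + v\<^sup>2) \<le> 1" by simp
    moreover have "1 \<le> sqrt (1 + u\<^sup>2 + v\<^sup>2)" by simp
    ultimately have "(1 + v\<^sup>2) / (1 + u\<^sup>2 + v\<^sup>2) / sqrt (1 + u\<^sup>2 + v\<^sup>2) \<le> 1"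
      by (subst pos_divide_le_eq) linarith+
    then show "norm ((1 + v\<^sup>2) / (1 + u\<^sup>2 + v\<^sup>2) / sqrt (1 + u\<^sup>2 + v\<^sup>2)) \<le> 1"
      using q by simp
  qed (use d in auto)
  then show ?thesis by simp
qed

locale kinetic_lipschitz = kinetic +
  fixes L :: real
  assumes cont_F: "continuous_on ({a..b} \<times> UNIV) (\<lambda>(t, x). F t x)"
    and lip_F: "\<And>t x y. t \<in> {a..b} \<Longrightarrow> \<bar>F t x - F t y\<bar> \<le> L * \<bar>x - y\<bar>"
begin

text \<open>Since \<open>v2\<close> is constant, position and \<open>v1\<close> are the only
  unknowns of the differential equation. By \<open>transport\<close> the derivative of
  \<open>g\<close> along its solution is 0. Starting times are end points because the Picard lemmas
  start there.\<close>

lemma characteristic: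
  assumes t0: "t0 = a \<or> t0 = b"
  shows "\<exists>X V. X t0 = x0 \<and> V t0 = u0 \<and> (\<forall>t\<in>{a..b}.
    (X has_real_derivative fst (vhat (V t, v2))) (at t within {a..b}) \<and>
    (V has_real_derivative F t (X t)) (at t within {a..b}) \<and>
    g t (X t) (V t, v2) = g t0 x0 (u0, v2))"
proof -
  define G where "G t y = (fst (vhat (snd y, v2)), F t (fst y))" for t and y :: "real \<times> real"
  have "continuous_on ({a..b} \<times> UNIV) (\<lambda>z. (\<lambda>(t, x). F t x) (fst z, fst (snd z)))"
    by (rule continuous_on_compose2[OF cont_F]) (auto intro!: continuous_intros)
  then have cF: "continuous_on ({a..b} \<times> UNIV) (\<lambda>z. F (fst z) (fst (snd z)))" by simp
  have cont_G: "continuous_on ({a..b} \<times> UNIV) (\<lambda>(t, y). G t y)"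
    unfolding G_def case_prod_unfold
    by (intro continuous_on_Pair cF continuous_on_compose2[OF cont_vhat[of UNIV]] continuous_intros) auto
  have lip_G: "norm (G t y - G t z) \<le> (1 + \<bar>L\<bar>) * norm (y - z)" if t: "t \<in> {a..b}" for t y z
  proof -
    have "norm (G t y - G t z) \<le> \<bar>fst (vhat (snd y, v2)) - fst (vhat (snd z, v2))\<bar> + \<bar>F t (fst y) - F t (fst z)\<bar>"
      using norm_Pair_le[of "fst (G t y - G t z)" "snd (G t y - G t z)"] by (simp add: G_def)
    also have "\<dots> \<le> \<bar>snd y - snd z\<bar> + \<bar>L\<bar> * \<bar>fst y - fst z\<bar>"
      using fst_vhat_lipschitz lip_F[OF t, of "fst y" "fst z"]
        mult_right_mono[OF abs_ge_self[of L], of "\<bar>fst y - fst z\<bar>"]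
      by (smt (verit) abs_ge_zero)
    also have "\<dots> \<le> norm (y - z) + \<bar>L\<bar> * norm (y - z)"
      using norm_fst_le[of "fst y - fst z" "snd y - snd z"] norm_snd_le[of "snd y - snd z" "fst y - fst z"]
      by (intro add_mono mult_left_mono) (auto simp: minus_prod_def)
    finally show ?thesis by (simp add: algebra_simps)
  qed
  have "\<exists>y. y t0 = (x0, u0) \<and> (\<forall>t\<in>{a..b}. (y has_vector_derivative G t (y t)) (at t within {a..b}))"
    using t0 picard_forward[OF ab(2) cont_G lip_G] picard_backward[OF ab(2) cont_G lip_G] by blast
  then obtain y where y0: "y t0 = (x0, u0)"
    and y: "\<And>t. t \<in> {a..b} \<Longrightarrow> (y has_vector_derivative G t (y t)) (at t within {a..b})" by blast
  define X where "X t = fst (y t)" for t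
  define V where "V t = snd (y t)" for t
  have X: "(X has_real_derivative fst (vhat (V t, v2))) (at t within {a..b})" if "t \<in> {a..b}" for t
    using bounded_linear.has_vector_derivative[OF bounded_linear_fst y[OF that]]
    by (simp add: X_def[abs_def] V_def G_def has_real_derivative_iff_has_vector_derivative)
  have V: "(V has_real_derivative F t (X t)) (at t within {a..b})" if "t \<in> {a..b}" for t
    using bounded_linear.has_vector_derivative[OF bounded_linear_snd y[OF that]]
    by (simp add: X_def V_def[abs_def] G_def has_real_derivative_iff_has_vector_derivative)
  have "((\<lambda>t. g t (X t) (V t, v2)) has_real_derivative 0) (at t within {a..b})" if t: "t \<in> {a..b}" for t
  proof -
    have "((\<lambda>t. g t (X t) (V t, v2)) has_real_derivative
        blinfun_apply (D (t, X t, V t, v2)) (1, fst (vhat (V t, v2)), F t (X t), 0)) (at t within {a..b})"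
      using V[OF t] ab t
      by (intro deriv_along X) (auto intro!: derivative_eq_intros has_vector_derivative_Pair
        simp: has_real_derivative_iff_has_vector_derivative)
    then show ?thesis using transport[OF t] by simp
  qed
  then have "\<exists>c. \<forall>t\<in>{a..b}. g t (X t) (V t, v2) = c"
    by (intro has_field_derivative_zero_constant) auto
  then obtain c where c: "\<And>t. t \<in> {a..b} \<Longrightarrow> g t (X t) (V t, v2) = c" by blast
  have "t0 \<in> {a..b}" using t0 ab by auto
  moreover have "X t0 = x0" "V t0 = u0" using y0 by (auto simp: X_def V_def)
  ultimately have "g t0 x0 (u0, v2) = c" using c[of t0] by simp
  with \<open>X t0 = x0\<close> \<open>V t0 = u0\<close> c X V show ?thesis by (intro exI[of _ X] exI[of _ V]) simp
qed

text \<open>The characteristic through a support point at \<open>t0\<close> lies in the support at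
  \<open>t1\<close> as well. In between, position changes at speed at most 1, \<open>v1\<close> at
  rate at most \<open>B\<close>, and \<open>v2\<close> not at all.\<close>

lemma support_growth_endpoints:
  assumes "t0 = a \<or> t0 = b" "t1 = a \<or> t1 = b"
    and B: "\<And>t x. t \<in> {a..b} \<Longrightarrow> \<bar>F t x\<bar> \<le> B"
    and m: "\<And>x v. g t1 x v \<noteq> 0 \<Longrightarrow> \<bar>x\<bar> \<le> m \<and> norm v \<le> m"
    and nz: "g t0 x v \<noteq> 0"
  shows "\<bar>x\<bar> \<le> m + (1 + B) * (b - a) \<and> norm v \<le> m + (1 + B) * (b - a)"
proof -
  obtain v1 v2 where v: "v = (v1, v2)" by (cases v)
  obtain X V where XV: "X t0 = x" "V t0 = v1" and
    X: "\<And>t. t \<in> {a..b} \<Longrightarrow> (X has_real_derivative fst (vhat (V t, v2))) (at t within {a..b})" and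
    V: "\<And>t. t \<in> {a..b} \<Longrightarrow> (V has_real_derivative F t (X t)) (at t within {a..b})" and
    g: "\<And>t. t \<in> {a..b} \<Longrightarrow> g t (X t) (V t, v2) = g t0 x (v1, v2)"
    using characteristic[OF assms(1), of x v1 v2] by blast
  have t: "t0 \<in> {a..b}" "t1 \<in> {a..b}" using assms(1,2) ab by auto
  have B0: "0 \<le> B" using B[OF t(1), of 0] by simp
  have le: "norm (t0 - t1) \<le> b - a" using t by auto
  have "norm (X t0 - X t1) \<le> 1 * norm (t0 - t1)"
    by (rule field_differentiable_bound[of "{a..b}"]) (use X t abs_fst_vhat_le in auto)
  moreover have "norm (V t0 - V t1) \<le> B * norm (t0 - t1)"
    by (rule field_differentiable_bound[of "{a..b}"]) (use V t B in auto)
  moreover have "B * norm (t0 - t1) \<le> B * (b - a)" using le B0 by (rule mult_left_mono)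
  moreover have "\<bar>X t1\<bar> \<le> m" "norm (V t1, v2) \<le> m"
    using m[of "X t1" "(V t1, v2)"] g[OF t(2)] nz v by auto
  moreover have "norm v \<le> norm (V t1, v2) + \<bar>V t0 - V t1\<bar>"
    using norm_triangle_ineq[of "(V t1, v2)" "(V t0 - V t1, 0)"] XV v by (simp add: norm_Pair)
  moreover have "0 \<le> b - a" "(1 + B) * (b - a) = (b - a) + B * (b - a)" "0 \<le> B * (b - a)"
    using ab B0 by (auto simp: algebra_simps mult_left_mono)
  ultimately show ?thesis using XV le by (auto simp: abs_le_iff)
qed

end

subsection \<open>Solutions with uniformly bounded support\<close>

text \<open>A solution with a fixed choice \<open>D\<close> of the total derivatives. Compactness of
  the supports is assumed for each time separately.\<close>

locale vlasov =
  fixes N :: nat and e :: "nat \<Rightarrow> real" and f :: densities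
    and D :: "nat \<Rightarrow> real \<times> real \<times> real \<times> real \<Rightarrow> ((real \<times> real \<times> real \<times> real) \<Rightarrow>\<^sub>L real)"
  assumes deriv: "\<And>\<alpha> z. \<alpha> \<in> {1..N} \<Longrightarrow> z \<in> {0..} \<times> UNIV \<Longrightarrow>
        ((\<lambda>(t, x, v). f \<alpha> t x v) has_derivative blinfun_apply (D \<alpha> z)) (at z within {0..} \<times> UNIV)"
    and cont_D: "\<And>\<alpha>. \<alpha> \<in> {1..N} \<Longrightarrow> continuous_on ({0..} \<times> UNIV) (D \<alpha>)"
    and compact_supp: "\<And>\<alpha> t. \<alpha> \<in> {1..N} \<Longrightarrow> 0 \<le> t \<Longrightarrow> compactly_supported (\<lambda>(x, v). f \<alpha> t x v)"
    and nonneg: "\<And>\<alpha> t x v. \<alpha> \<in> {1..N} \<Longrightarrow> 0 \<le> t \<Longrightarrow> 0 \<le> f \<alpha> t x v"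
    and transport: "\<And>\<alpha> t x v. \<alpha> \<in> {1..N} \<Longrightarrow> 0 \<le> t \<Longrightarrow>
        blinfun_apply (D \<alpha> (t, x, v)) (1, fst (vhat v), e \<alpha> * E1 N e f t x, 0) = 0"
begin

definition confined :: "real \<Rightarrow> real \<Rightarrow> bool" where
  "confined n t \<longleftrightarrow> (\<forall>\<alpha>\<in>{1..N}. \<forall>x v. f \<alpha> t x v \<noteq> 0 \<longrightarrow> \<bar>x\<bar> \<le> n \<and> norm v \<le> n)"

definition number :: "real \<Rightarrow> real \<Rightarrow> real" where
  "number t x = (\<Sum>\<alpha>\<in>{1..N}. mom (\<lambda>_. 1) (f \<alpha> t x))"

definition total_mass :: "real \<Rightarrow> real" where
  "total_mass t = integral UNIV (number t)"

definition charge_bound :: real where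
  "charge_bound = (\<Sum>\<alpha>\<in>{1..N}. \<bar>e \<alpha>\<bar>)"

lemma charge_bound: "\<alpha> \<in> {1..N} \<Longrightarrow> \<bar>e \<alpha>\<bar> \<le> charge_bound" "0 \<le> charge_bound"
  unfolding charge_bound_def by (auto intro!: member_le_sum sum_nonneg)

end

locale vlasov_slab = vlasov +
  fixes a b n :: real
  assumes ab: "0 \<le> a" "a \<le> b" and n: "0 \<le> n"
    and confined: "\<And>t. t \<in> {a..b} \<Longrightarrow> confined n t"
begin

lemma kinetic: "\<alpha> \<in> {1..N} \<Longrightarrow> kinetic (f \<alpha>) (D \<alpha>) (\<lambda>t x. e \<alpha> * E1 N e f t x) a b n"
  using ab n confined deriv cont_D transport
  unfolding kinetic_def confined_def by auto

lemma slice: "\<alpha> \<in> {1..N} \<Longrightarrow> t \<in> {a..b} \<Longrightarrow> phase_slice (f \<alpha> t x) n"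
  using kinetic.slice[OF kinetic] .

lemma mom_nonneg: "\<alpha> \<in> {1..N} \<Longrightarrow> t \<in> {a..b} \<Longrightarrow> 0 \<le> mom (\<lambda>_. 1) (f \<alpha> t x)"
  unfolding mom_def using ab
  by (intro integral_nonneg phase_slice.integrable_mom[OF slice]) (auto intro!: nonneg)

text \<open>Conservation of the density with weights \<open>c \<alpha>\<close>: charge for \<open>c = e\<close>, particle number for \<open>c = 1\<close>.\<close>
lemma conservation_law_weighted:
  "conservation_law
     (\<lambda>t x. \<Sum>\<alpha>\<in>{1..N}. c \<alpha> * mom (\<lambda>_. 1) (f \<alpha> t x))
     (\<lambda>t x. \<Sum>\<alpha>\<in>{1..N}. c \<alpha> * kinetic.mom_t (D \<alpha>) n (\<lambda>_. 1) t x)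
     (\<lambda>t x. \<Sum>\<alpha>\<in>{1..N}. c \<alpha> * mom (\<lambda>v. fst (vhat v)) (f \<alpha> t x)) a b n"
proof unfold_locales
  show "continuous_on ({a..b} \<times> UNIV) (\<lambda>(t, x). \<Sum>\<alpha>\<in>{1..N}. c \<alpha> * mom (\<lambda>_. 1) (f \<alpha> t x))"
    unfolding case_prod_unfold
    by (intro continuous_intros kinetic.mom_continuous[unfolded case_prod_unfold, OF kinetic]) auto
  show "continuous_on ({a..b} \<times> UNIV) (\<lambda>(t, x). \<Sum>\<alpha>\<in>{1..N}. c \<alpha> * kinetic.mom_t (D \<alpha>) n (\<lambda>_. 1) t x)"
    unfolding case_prod_unfold
    by (intro continuous_intros kinetic.mom_t_continuous[unfolded case_prod_unfold, OF kinetic]) auto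
  fix t x assume t: "t \<in> {a..b}"
  show "((\<lambda>t. \<Sum>\<alpha>\<in>{1..N}. c \<alpha> * mom (\<lambda>_. 1) (f \<alpha> t x)) has_real_derivative
      (\<Sum>\<alpha>\<in>{1..N}. c \<alpha> * kinetic.mom_t (D \<alpha>) n (\<lambda>_. 1) t x)) (at t within {a..b})"
    by (intro DERIV_sum DERIV_cmult kinetic.mom_has_time_derivative[OF kinetic] t) auto
  have "((\<lambda>x. mom (\<lambda>v. fst (vhat v)) (f \<alpha> t x)) has_real_derivative
      - kinetic.mom_t (D \<alpha>) n (\<lambda>_. 1) t x) (at x)" if "\<alpha> \<in> {1..N}" for \<alpha>
    using kinetic.mom_transport[OF kinetic[OF that] _ t, of "\<lambda>_. 1" "\<lambda>_. 0" x] by (simp add: mom_def)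
  then show "((\<lambda>x. \<Sum>\<alpha>\<in>{1..N}. c \<alpha> * mom (\<lambda>v. fst (vhat v)) (f \<alpha> t x)) has_real_derivative
      - (\<Sum>\<alpha>\<in>{1..N}. c \<alpha> * kinetic.mom_t (D \<alpha>) n (\<lambda>_. 1) t x)) (at x)"
    unfolding sum_negf[symmetric] mult_minus_right[symmetric] by (intro DERIV_sum DERIV_cmult)
  assume "n < \<bar>x\<bar>"
  then show "(\<Sum>\<alpha>\<in>{1..N}. c \<alpha> * mom (\<lambda>_. 1) (f \<alpha> t x)) = 0"
    "(\<Sum>\<alpha>\<in>{1..N}. c \<alpha> * mom (\<lambda>v. fst (vhat v)) (f \<alpha> t x)) = 0"
    using kinetic.mom_outside[OF kinetic t] by (auto intro!: sum.neutral)
qed (use ab n in auto)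

lemma rho_eq: "t \<in> {a..b} \<Longrightarrow> rho N e f t x = (\<Sum>\<alpha>\<in>{1..N}. e \<alpha> * mom (\<lambda>_. 1) (f \<alpha> t x))"
  unfolding rho_def
  by (simp add: phase_slice.integrable_lborel[OF slice] phase_slice.lborel_integral[OF slice])

definition current :: "real \<Rightarrow> real \<Rightarrow> real" where
  "current t x = (\<Sum>\<alpha>\<in>{1..N}. e \<alpha> * mom (\<lambda>v. fst (vhat v)) (f \<alpha> t x))"

sublocale charge: conservation_law "\<lambda>t x. \<Sum>\<alpha>\<in>{1..N}. e \<alpha> * mom (\<lambda>_. 1) (f \<alpha> t x)"
    "\<lambda>t x. \<Sum>\<alpha>\<in>{1..N}. e \<alpha> * kinetic.mom_t (D \<alpha>) n (\<lambda>_. 1) t x" current a b n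
  using conservation_law_weighted[of e] by (simp add: current_def[abs_def])

sublocale mass: conservation_law number
    "\<lambda>t x. \<Sum>\<alpha>\<in>{1..N}. kinetic.mom_t (D \<alpha>) n (\<lambda>_. 1) t x"
    "\<lambda>t x. \<Sum>\<alpha>\<in>{1..N}. mom (\<lambda>v. fst (vhat v)) (f \<alpha> t x)" a b n
  using conservation_law_weighted[of "\<lambda>_. 1"] by (simp add: number_def[abs_def])

lemma supported_rho: assumes "t \<in> {a..b}" shows "supported (rho N e f t) n"
proof -
  have "rho N e f t = (\<lambda>x. \<Sum>\<alpha>\<in>{1..N}. e \<alpha> * mom (\<lambda>_. 1) (f \<alpha> t x))"
    using rho_eq[OF assms] by blast
  then show ?thesis using charge.supported_slice[OF assms] by simp
qed

lemma rho_le_number: "t \<in> {a..b} \<Longrightarrow> \<bar>rho N e f t x\<bar> \<le> charge_bound * number t x"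
  unfolding rho_eq number_def sum_distrib_left
  by (intro sum_abs[THEN order_trans] sum_mono)
     (auto simp: abs_mult mom_nonneg intro!: mult_right_mono charge_bound)

lemma number_nonneg: "t \<in> {a..b} \<Longrightarrow> 0 \<le> number t x"
  unfolding number_def by (intro sum_nonneg mom_nonneg)

lemma total_mass_eq: "t \<in> {a..b} \<Longrightarrow> total_mass t = cumul (number t) n"
  unfolding total_mass_def by (intro integral_unique supported.has_integral_UNIV mass.supported_slice)

lemma total_mass_constant: "t \<in> {a..b} \<Longrightarrow> s \<in> {a..b} \<Longrightarrow> total_mass t = total_mass s"
  using mass.total_constant[of t s] by (simp add: total_mass_eq)

lemma E1_eq: "t \<in> {a..b} \<Longrightarrow> E1 N e f t x = cumul (rho N e f t) x - cumul (rho N e f t) n / 2"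
  using supported.set_lborel_integral_atMost[OF supported_rho] supported.set_lborel_integral_atLeast[OF supported_rho]
  by (simp add: E1_def)

lemma supported_number_scaled: "t \<in> {a..b} \<Longrightarrow> supported (\<lambda>x. K * number t x) n"
  using mass.cont_slice[of t UNIV] mass.A_outside[of t] n
  by unfold_locales (auto intro!: continuous_intros)

lemma cumul_scaled: "cumul (\<lambda>x. K * A x) x = K * cumul A x"
  by (simp add: cumul_def)

lemma rho_cumul_le: assumes "t \<in> {a..b}" shows "\<bar>cumul (rho N e f t) x\<bar> \<le> charge_bound * total_mass t"
proof -
  have "\<bar>cumul (rho N e f t) x\<bar> \<le> cumul (\<lambda>x. charge_bound * number t x) x"
    by (intro cumul_abs_le[of _ n] supported_rho supported_number_scaled assms rho_le_number)
  also have "\<dots> \<le> charge_bound * total_mass t"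
    unfolding cumul_scaled total_mass_eq[OF assms]
    by (intro mult_left_mono supported.cumul_bounds mass.supported_slice number_nonneg assms charge_bound)
  finally show ?thesis .
qed

text \<open>The bound involves the particle number but not the radius \<open>n\<close>, which makes
  the growth rate in \<open>support_growth\<close> independent of the slab. The factor 2 rounds up
  \<open>3 / 2\<close>.\<close>

lemma E1_le: "t \<in> {a..b} \<Longrightarrow> \<bar>E1 N e f t x\<bar> \<le> 2 * charge_bound * total_mass t"
  using rho_cumul_le[of t x] rho_cumul_le[of t n] by (simp add: E1_eq)

lemma E1_continuous: "continuous_on ({a..b} \<times> UNIV) (\<lambda>(t, x). E1 N e f t x)"
proof -
  let ?A = "\<lambda>t x. \<Sum>\<alpha>\<in>{1..N}. e \<alpha> * mom (\<lambda>_. 1) (f \<alpha> t x)"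
  have "continuous_on ({a..b} \<times> UNIV) (\<lambda>z. (\<lambda>(t, x). cumul (?A t) x) z - (\<lambda>(t, x). cumul (?A t) x) (fst z, n) / 2)"
    by (intro continuous_intros charge.cumul_continuous continuous_on_compose2[OF charge.cumul_continuous]) auto
  moreover have "rho N e f t = ?A t" if "t \<in> {a..b}" for t using rho_eq[OF that] by blast
  ultimately show ?thesis
    by (elim continuous_on_eq) (auto simp: E1_eq)
qed

lemma E1_space_derivative:
  assumes t: "t \<in> {a..b}" shows "(E1 N e f t has_real_derivative rho N e f t x) (at x)"
proof -
  have "E1 N e f t = (\<lambda>x. cumul (rho N e f t) x - cumul (rho N e f t) n / 2)"
    using E1_eq[OF t] by blast
  then show ?thesis
    using supported.cumul_has_derivative[OF supported_rho[OF t], of x]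
    by (auto intro!: derivative_eq_intros)
qed

lemma rho_bounded: "\<exists>L. \<forall>t\<in>{a..b}. \<forall>x. \<bar>rho N e f t x\<bar> \<le> L"
proof -
  let ?A = "\<lambda>(t, x). \<Sum>\<alpha>\<in>{1..N}. e \<alpha> * mom (\<lambda>_. 1) (f \<alpha> t x)"
  have "bounded (?A ` ({a..b} \<times> {-n..n}))"
    by (intro compact_imp_bounded compact_continuous_image compact_Times continuous_on_subset[OF charge.cont_A]) auto
  then obtain L where L: "\<forall>z\<in>{a..b} \<times> {-n..n}. \<bar>?A z\<bar> \<le> L" by (auto simp: bounded_iff)
  have "\<bar>rho N e f t x\<bar> \<le> \<bar>L\<bar>" if t: "t \<in> {a..b}" for t x
  proof (cases "\<bar>x\<bar> \<le> n")
    case True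
    then show ?thesis using L[rule_format, of "(t, x)"] t by (force simp: rho_eq abs_le_iff)
  next
    case False
    then show ?thesis using supported.outside[OF supported_rho[OF t], of x] by simp
  qed
  then show ?thesis by blast
qed

lemma kinetic_lipschitz:
  assumes \<alpha>: "\<alpha> \<in> {1..N}"
  shows "\<exists>L. kinetic_lipschitz (f \<alpha>) (D \<alpha>) (\<lambda>t x. e \<alpha> * E1 N e f t x) a b n L"
proof -
  obtain L where L: "\<And>t x. t \<in> {a..b} \<Longrightarrow> \<bar>rho N e f t x\<bar> \<le> L" using rho_bounded by blast
  have "kinetic_lipschitz (f \<alpha>) (D \<alpha>) (\<lambda>t x. e \<alpha> * E1 N e f t x) a b n (\<bar>e \<alpha>\<bar> * L)"
  proof (intro kinetic_lipschitz.intro kinetic_lipschitz_axioms.intro kinetic \<alpha>)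
    show "continuous_on ({a..b} \<times> UNIV) (\<lambda>(t, x). e \<alpha> * E1 N e f t x)"
      using E1_continuous by (auto simp: case_prod_unfold intro!: continuous_intros)
    fix t x y assume t: "t \<in> {a..b}"
    have "norm (E1 N e f t x - E1 N e f t y) \<le> L * norm (x - y)"
      by (rule field_differentiable_bound[of UNIV])
         (use E1_space_derivative[OF t] L[OF t] in \<open>auto intro: DERIV_subset\<close>)
    then show "\<bar>e \<alpha> * E1 N e f t x - e \<alpha> * E1 N e f t y\<bar> \<le> \<bar>e \<alpha>\<bar> * L * \<bar>x - y\<bar>"
      by (simp add: abs_mult mult_left_mono mult.assoc flip: right_diff_distrib)
  qed
  then show ?thesis by blast
qed

end

text \<open>Mass is constant in the slab, so the force is at most
  \<open>2 * charge_bound ^ 2 * M\<close>. The radius \<open>n\<close> of the slab does not enter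
  the conclusion; it only ensures that characteristics exist.\<close>

lemma (in vlasov) support_growth:
  assumes slab: "vlasov_slab N e f D a b n" and t: "s \<in> {a..b}" "t \<in> {a..b}" and s: "confined m s"
    and M: "total_mass s \<le> M"
  shows "confined (m + (1 + 2 * charge_bound ^ 2 * M) * (b - a)) t"
proof -
  \<comment> \<open>On the interval between \<open>s\<close> and \<open>t\<close> both are end
    points, as \<open>support_growth_endpoints\<close> requires.\<close>
  define a' where "a' = min s t"
  define b' where "b' = max s t"
  interpret S: vlasov_slab N e f D a b n by (rule slab)
  interpret S': vlasov_slab N e f D a' b' n
    using S.ab S.n S.confined t by unfold_locales (auto simp: a'_def b'_def min_def max_def split: if_splits)
  have mass: "total_mass r = total_mass s" if "r \<in> {a'..b'}" for r
    using S.total_mass_constant[of r s] t that by (auto simp: a'_def b'_def min_def max_def split: if_splits)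
  have mass0: "0 \<le> total_mass s"
    using supported.cumul_bounds(1)[OF S.mass.supported_slice[OF t(1)] S.number_nonneg[OF t(1)], where x = n]
    by (simp add: S.total_mass_eq[OF t(1)])
  show ?thesis
    unfolding confined_def
  proof (intro ballI allI impI)
    fix \<alpha> x v assume \<alpha>: "\<alpha> \<in> {1..N}" and nz: "f \<alpha> t x v \<noteq> 0"
    obtain L where "kinetic_lipschitz (f \<alpha>) (D \<alpha>) (\<lambda>t x. e \<alpha> * E1 N e f t x) a' b' n L"
      using S'.kinetic_lipschitz[OF \<alpha>] by blast
    then interpret K: kinetic_lipschitz "f \<alpha>" "D \<alpha>" "\<lambda>t x. e \<alpha> * E1 N e f t x" a' b' n L .
    let ?B = "2 * charge_bound ^ 2 * M"
    have B: "\<bar>e \<alpha> * E1 N e f r x\<bar> \<le> ?B" if r: "r \<in> {a'..b'}" for r x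
    proof -
      have "\<bar>e \<alpha> * E1 N e f r x\<bar> \<le> charge_bound * (2 * charge_bound * total_mass r)"
        unfolding abs_mult by (intro mult_mono charge_bound \<alpha> S'.E1_le r) auto
      also have "\<dots> \<le> charge_bound * (2 * charge_bound * M)"
        using mass[OF r] M charge_bound by (intro mult_left_mono) auto
      finally show ?thesis by (simp add: power2_eq_square)
    qed
    have "\<bar>x\<bar> \<le> m + (1 + ?B) * (b' - a') \<and> norm v \<le> m + (1 + ?B) * (b' - a')"
      by (rule K.support_growth_endpoints[of t s, OF _ _ B])
         (use s \<alpha> nz in \<open>auto simp: confined_def a'_def b'_def min_def max_def\<close>)
    moreover have "(1 + ?B) * (b' - a') \<le> (1 + ?B) * (b - a)"
      using t mass0 M by (intro mult_left_mono) (auto simp: a'_def b'_def)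
    ultimately show "\<bar>x\<bar> \<le> m + (1 + ?B) * (b - a) \<and> norm v \<le> m + (1 + ?B) * (b - a)" by linarith
  qed
qed

subsection \<open>The supports are locally bounded uniformly in time\<close>

text \<open>
  Times near which the supports are uniformly bounded form an open set, on whose components the mass
  is conserved and the supports grow at most linearly. By the Baire property, the closed set \<open>F\<close> of
  the other times, if nonempty, has a point near which the supports are uniformly bounded at the
  times in \<open>F\<close>; growth across the gaps of \<open>F\<close> is controlled from their end points in \<open>F\<close>.
\<close>

lemma max_minus_min: "max x y - min x y = \<bar>x - y\<bar>" for x y :: real
  by auto

context vlasov
begin

lemma confined_mono: "confined n t \<Longrightarrow> n \<le> m \<Longrightarrow> confined m t"
  unfolding confined_def by (meson order_trans)

lemma continuous_in_time:
  assumes "\<alpha> \<in> {1..N}" shows "continuous_on {0..} (\<lambda>t. f \<alpha> t x v)"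
proof -
  have c: "continuous_on ({0..} \<times> UNIV) (\<lambda>(t, x, v). f \<alpha> t x v)"
    unfolding continuous_on_eq_continuous_within
    using deriv[OF assms] has_derivative_continuous by blast
  have "continuous_on {0..} (\<lambda>t. (\<lambda>(t, x, v). f \<alpha> t x v) (t, x, v))"
    by (rule continuous_on_compose2[OF c]) (auto intro!: continuous_intros)
  then show ?thesis by simp
qed

lemma confined_exists:
  assumes t: "0 \<le> t" shows "\<exists>k::nat. confined (real k) t"
proof -
  have "\<exists>K. \<forall>x v. f \<alpha> t x v \<noteq> 0 \<longrightarrow> norm (x, v) \<le> K" if \<alpha>: "\<alpha> \<in> {1..N}" for \<alpha>
  proof -
    have "bounded {z. (\<lambda>(x, v). f \<alpha> t x v) z \<noteq> 0}"
      using compact_supp[OF \<alpha> t] bounded_subset[OF compact_imp_bounded closure_subset]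
      unfolding compactly_supported_def by blast
    then show ?thesis by (auto simp: bounded_iff)
  qed
  then obtain K where K: "\<And>\<alpha> x v. \<alpha> \<in> {1..N} \<Longrightarrow> f \<alpha> t x v \<noteq> 0 \<Longrightarrow> norm (x, v) \<le> K \<alpha>" by metis
  obtain k :: nat where k: "(\<Sum>\<alpha>\<in>{1..N}. \<bar>K \<alpha>\<bar>) \<le> real k" using real_arch_simple by blast
  have "confined (real k) t"
    unfolding confined_def
  proof (intro ballI allI impI)
    fix \<alpha> x v assume \<alpha>: "\<alpha> \<in> {1..N}" and "f \<alpha> t x v \<noteq> 0"
    then have "norm (x, v) \<le> K \<alpha>" by (rule K)
    also have "\<dots> \<le> \<bar>K \<alpha>\<bar>" by simp
    also have "\<dots> \<le> (\<Sum>\<alpha>\<in>{1..N}. \<bar>K \<alpha>\<bar>)" by (rule member_le_sum[OF \<alpha>]) auto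
    finally show "\<bar>x\<bar> \<le> real k \<and> norm v \<le> real k"
      using norm_fst_le[of x v] norm_snd_le[of v x] k by simp
  qed
  then show ?thesis ..
qed

text \<open>For a fixed phase point outside the radius, the density is continuous in time, so its
  zero set is closed; the set in question is an intersection of such sets.\<close>

lemma closed_confined: "closed {t. 0 \<le> t \<and> confined n t}"
proof -
  have "closed {t \<in> {0..}. f \<alpha> t x v = 0}" if "\<alpha> \<in> {1..N}" for \<alpha> x v
    by (rule continuous_closed_preimage_constant[OF continuous_in_time[OF that]]) auto
  then have "closed ({0..} \<inter> (\<Inter>\<alpha>\<in>{1..N}. \<Inter>(x, v)\<in>{(x, v). \<not> (\<bar>x\<bar> \<le> n \<and> norm v \<le> n)}. {t \<in> {0..}. f \<alpha> t x v = 0}))"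
    by (intro closed_Int closed_INT ballI) (auto simp: case_prod_unfold)
  also have "{0..} \<inter> (\<Inter>\<alpha>\<in>{1..N}. \<Inter>(x, v)\<in>{(x, v). \<not> (\<bar>x\<bar> \<le> n \<and> norm v \<le> n)}. {t \<in> {0..}. f \<alpha> t x v = 0})
    = {t. 0 \<le> t \<and> confined n t}"
    by (auto simp: confined_def)
  finally show ?thesis .
qed

lemma slabI:
  assumes "0 \<le> a" "a \<le> b" "0 \<le> n" "\<And>t. t \<in> {a..b} \<Longrightarrow> confined n t"
  shows "vlasov_slab N e f D a b n"
  using assms vlasov_axioms by (simp add: vlasov_slab_def vlasov_slab_axioms_def)

lemma total_mass_nonneg:
  assumes t: "0 \<le> t" shows "0 \<le> total_mass t"
proof -
  obtain k where "confined (real k) t" using confined_exists[OF t] by blast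
  then interpret vlasov_slab N e f D t t k by (intro slabI t) auto
  show ?thesis
    using supported.cumul_bounds(1)[OF mass.supported_slice number_nonneg, of t k] by (simp add: total_mass_eq)
qed

text \<open>Mass conservation is available only inside slabs and cannot compare scattered times.
  Instead, the densities are bounded on a compact set of times, positions and momenta that contains
  all the supports in question.\<close>

lemma total_mass_bounded:
  assumes "0 \<le> a" "0 \<le> n"
  shows "\<exists>M\<ge>0. \<forall>t\<in>{a..b}. confined n t \<longrightarrow> total_mass t \<le> M"
proof -
  have "\<exists>C. \<forall>t\<in>{a..b}. \<forall>x\<in>{-n..n}. \<forall>v\<in>vbox n. \<bar>f \<alpha> t x v\<bar> \<le> C" if \<alpha>: "\<alpha> \<in> {1..N}" for \<alpha>
  proof -
    have "continuous_on ({0..} \<times> UNIV) (\<lambda>(t, x, v). f \<alpha> t x v)"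
      unfolding continuous_on_eq_continuous_within
      using deriv[OF \<alpha>] has_derivative_continuous by blast
    then have "bounded ((\<lambda>(t, x, v). f \<alpha> t x v) ` ({a..b} \<times> {-n..n} \<times> vbox n))"
      using \<open>0 \<le> a\<close> by (intro compact_imp_bounded compact_continuous_image compact_Times)
        (auto intro: continuous_on_subset)
    then show ?thesis by (fastforce simp: bounded_iff)
  qed
  then obtain C where C: "\<And>\<alpha> t x v. \<alpha> \<in> {1..N} \<Longrightarrow> t \<in> {a..b} \<Longrightarrow> x \<in> {-n..n} \<Longrightarrow> v \<in> vbox n \<Longrightarrow> \<bar>f \<alpha> t x v\<bar> \<le> C \<alpha>"
    by metis
  define K where "K = (\<Sum>\<alpha>\<in>{1..N}. measure lborel (vbox n) * C \<alpha>)"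
  have "total_mass t \<le> \<bar>2 * n * K\<bar>" if t: "t \<in> {a..b}" "confined n t" for t
  proof -
    interpret vlasov_slab N e f D t t n using t assms by (intro slabI) auto
    have "number t x \<le> K" if x: "x \<in> {-n..n}" for x
      unfolding number_def K_def
    proof (rule sum_mono)
      fix \<alpha> assume \<alpha>: "\<alpha> \<in> {1..N}"
      interpret S: phase_slice "f \<alpha> t x" n using slice[OF \<alpha>] by simp
      have "integral (vbox n) (\<lambda>v. 1 * f \<alpha> t x v) \<le> integral (vbox n) (\<lambda>v. C \<alpha>)"
        using C[OF \<alpha> t(1) x] by (intro integral_le integrable_continuous continuous_intros continuous_on_subset[OF S.cont]) (auto simp: abs_le_iff)
      then show "mom (\<lambda>_. 1) (f \<alpha> t x) \<le> measure lborel (vbox n) * C \<alpha>" by (simp add: S.mom_eq)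
    qed
    then have "integral {-n..n} (number t) \<le> integral {-n..n} (\<lambda>_. K)"
      by (intro integral_le supported.integrable_Icc[OF mass.supported_slice]) auto
    then show ?thesis
      using \<open>0 \<le> n\<close> by (simp add: total_mass_eq supported.cumul_eq[OF mass.supported_slice order_refl])
  qed
  then show ?thesis by (intro exI[of _ "\<bar>2 * n * K\<bar>"]) auto
qed

definition locally_confined :: "real \<Rightarrow> bool" where
  "locally_confined r \<longleftrightarrow> (\<exists>\<epsilon>>0. \<exists>k\<ge>0. \<forall>t\<ge>0. \<bar>t - r\<bar> < \<epsilon> \<longrightarrow> confined k t)"

lemma open_locally_confined: "open {r. locally_confined r}"
proof (rule openI)
  fix r assume "r \<in> {r. locally_confined r}"
  then obtain \<epsilon> k where \<epsilon>: "\<epsilon> > 0" "k \<ge> 0" "\<And>t. t \<ge> 0 \<Longrightarrow> \<bar>t - r\<bar> < \<epsilon> \<Longrightarrow> confined k t"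
    unfolding locally_confined_def by blast
  have "locally_confined s" if "s \<in> ball r (\<epsilon>/2)" for s
    unfolding locally_confined_def
    using \<epsilon> that by (intro exI[of _ "\<epsilon>/2"] exI[of _ k]) (auto simp: dist_real_def abs_if split: if_splits)
  then show "\<exists>\<epsilon>>0. ball r \<epsilon> \<subseteq> {r. locally_confined r}"
    using \<epsilon>(1) by (intro exI[of _ "\<epsilon>/2"]) auto
qed

lemma confined_compact:
  assumes "0 \<le> a" "\<And>r. r \<in> {a..b} \<Longrightarrow> locally_confined r"
  shows "\<exists>n\<ge>0. \<forall>t\<in>{a..b}. confined n t"
proof -
  obtain E k where E: "\<And>r. r \<in> {a..b} \<Longrightarrow> E r > 0" "\<And>r. r \<in> {a..b} \<Longrightarrow> 0 \<le> k r"
    "\<And>r t. r \<in> {a..b} \<Longrightarrow> t \<ge> 0 \<Longrightarrow> \<bar>t - r\<bar> < E r \<Longrightarrow> confined (k r) t"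
    using assms(2) unfolding locally_confined_def by metis
  obtain C where C: "C \<subseteq> {a..b}" "finite C" "{a..b} \<subseteq> (\<Union>r\<in>C. ball r (E r))"
    by (rule compactE_image[of "{a..b}" "{a..b}" "\<lambda>r. ball r (E r)"]) (use E(1) in force)+
  have "confined (\<Sum>r\<in>C. k r) t" if t: "t \<in> {a..b}" for t
  proof -
    obtain r where r: "r \<in> C" "t \<in> ball r (E r)" using C(3) t by blast
    then have "confined (k r) t" using E(3)[of r t] C(1) t \<open>0 \<le> a\<close> by (auto simp: dist_real_def abs_minus_commute)
    moreover have "k r \<le> (\<Sum>r\<in>C. k r)" using C r E(2) by (intro member_le_sum) auto
    ultimately show ?thesis by (rule confined_mono)
  qed
  moreover have "0 \<le> (\<Sum>r\<in>C. k r)" using C E(2) by (intro sum_nonneg) auto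
  ultimately show ?thesis by blast
qed

text \<open>Growth from \<open>t\<close> towards \<open>q\<close> is controlled by a radius that
  does not deteriorate as \<open>q\<close> is approached. The time \<open>q\<close>, which need not
  be locally confined, is then reached by \<open>closed_confined\<close>.\<close>

lemma confined_gap:
  assumes "0 \<le> q" "0 \<le> t" "q \<noteq> t"
    and good: "\<And>r. r \<in> {min q t..max q t} - {q} \<Longrightarrow> locally_confined r"
  shows "\<exists>n\<ge>0. \<forall>r\<in>{min q t..max q t}. confined n r"
proof -
  obtain k :: nat where k: "confined (real k) t" using confined_exists[OF assms(2)] by blast
  define c where "c = 1 + 2 * charge_bound ^ 2 * total_mass t"
  have c: "0 \<le> c" using total_mass_nonneg[OF assms(2)] by (simp add: c_def)
  define n where "n = k + c * \<bar>q - t\<bar>"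
  have away: "confined n r" if r: "r \<in> {min q t..max q t} - {q}" for r
  proof -
    obtain m where m: "m \<ge> 0" "\<forall>s\<in>{min r t..max r t}. confined m s"
    proof -
      have "locally_confined s" if "s \<in> {min r t..max r t}" for s
        by (rule good) (use that r assms(3) in \<open>auto simp: min_def max_def split: if_splits\<close>)
      moreover have "0 \<le> min r t" using r assms(1,2) by auto
      ultimately show ?thesis using confined_compact that by meson
    qed
    have "vlasov_slab N e f D (min r t) (max r t) m"
      using m r assms by (intro slabI) auto
    from support_growth[OF this _ _ k order_refl, of r]
    have "confined (k + c * \<bar>r - t\<bar>) r" by (simp add: c_def max_minus_min)
    moreover have "c * \<bar>r - t\<bar> \<le> c * \<bar>q - t\<bar>" using r c by (intro mult_left_mono) auto
    ultimately show ?thesis by (elim confined_mono) (auto simp: n_def)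
  qed
  have "closure {min q t<..<max q t} \<subseteq> {r. 0 \<le> r \<and> confined n r}"
    by (intro closure_minimal closed_confined) (use away assms in auto)
  moreover have "closure {min q t<..<max q t} = {min q t..max q t}"
    using assms(3) by (intro closure_greaterThanLessThan) auto
  moreover have "0 \<le> n" using c by (simp add: n_def)
  ultimately show ?thesis by (intro exI[of _ n]) auto
qed

lemma confined_on_bounded_times:
  "\<exists>n\<ge>0. \<forall>t\<in>{0..T}. confined n t"
proof -
  define F where "F = {r. 0 \<le> r \<and> \<not> locally_confined r}"
  have "F = {}"
  proof (rule ccontr)
    assume "F \<noteq> {}"
    have "closed F"
    proof -
      have "F = {0..} \<inter> - {r. locally_confined r}" by (auto simp: F_def)
      then show ?thesis using open_locally_confined by (simp add: closed_Int closed_Compl)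
    qed
    have "F \<subseteq> (\<Union>k. {t. 0 \<le> t \<and> confined (real k) t})"
      using confined_exists by (auto simp: F_def)
    from Baire_closed_cover[OF \<open>closed F\<close> \<open>F \<noteq> {}\<close> closed_confined this]
    obtain k p \<epsilon> where p: "p \<in> F" and \<epsilon>: "\<epsilon> > 0" and k: "F \<inter> ball p \<epsilon> \<subseteq> {t. 0 \<le> t \<and> confined (real k) t}"
      by blast
    obtain M where M: "M \<ge> 0" "\<And>t. t \<in> {0..p + \<epsilon>} \<Longrightarrow> confined k t \<Longrightarrow> total_mass t \<le> M"
      using total_mass_bounded[of 0 k "p + \<epsilon>"] by auto
    define c where "c = 1 + 2 * charge_bound ^ 2 * M"
    have c: "0 \<le> c" using M by (simp add: c_def)
    have "confined (k + c * \<epsilon>) t" if t: "0 \<le> t" "\<bar>t - p\<bar> < \<epsilon>" for t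
    proof (cases "t \<in> F")
      case True
      then have "confined k t" using k t by (auto simp: dist_real_def abs_minus_commute)
      then show ?thesis using c \<epsilon> by (elim confined_mono) auto
    next
      case False
      let ?I = "{min p t..max p t}"
      have "closed (F \<inter> ?I)" using \<open>closed F\<close> by (intro closed_Int closed_atLeastAtMost)
      moreover have "p \<in> F \<inter> ?I" using p by simp
      then have "F \<inter> ?I \<noteq> {}" by blast
      \<comment> \<open>On the way from \<open>p\<close> to \<open>t\<close>, \<open>q\<close> is
        the point of \<open>F\<close> nearest to \<open>t\<close>; beyond \<open>q\<close> the
        interval up to \<open>t\<close> avoids \<open>F\<close>.\<close>
      ultimately obtain q where q: "q \<in> F" "q \<in> ?I" and min: "\<And>y. y \<in> F \<inter> ?I \<Longrightarrow> dist t q \<le> dist t y"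
        using distance_attains_inf[of "F \<inter> ?I" t] by blast
      have "q \<noteq> t" "0 \<le> q" using q False by (auto simp: F_def)
      have "locally_confined r" if r: "r \<in> {min q t..max q t} - {q}" for r
      proof (rule ccontr)
        assume "\<not> locally_confined r"
        moreover have "0 \<le> r" "r \<in> ?I" using r q \<open>0 \<le> q\<close> t by auto
        ultimately have "dist t q \<le> dist t r" by (intro min) (auto simp: F_def)
        then show False using r by (auto simp: dist_real_def)
      qed
      then obtain n where n: "n \<ge> 0" "\<forall>r\<in>{min q t..max q t}. confined n r"
        using confined_gap[OF \<open>0 \<le> q\<close> t(1) \<open>q \<noteq> t\<close>] by blast
      have slab: "vlasov_slab N e f D (min q t) (max q t) n"
        using n \<open>0 \<le> q\<close> t by (intro slabI) auto
      have qp: "\<bar>q - p\<bar> < \<epsilon>" "\<bar>q - t\<bar> < \<epsilon>" using q t by auto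
      then have kq: "confined k q" using k q by (auto simp: dist_real_def abs_minus_commute)
      \<comment> \<open>Growth is now measured from \<open>q\<close>, where radius and mass are
        bounded independently of \<open>t\<close>.\<close>
      have "total_mass q \<le> M" by (rule M(2)) (use kq qp \<open>0 \<le> q\<close> in auto)
      from support_growth[OF slab _ _ kq this, of t]
      have "confined (k + c * \<bar>q - t\<bar>) t" by (simp add: c_def max_minus_min)
      moreover have "c * \<bar>q - t\<bar> \<le> c * \<epsilon>" using c qp by (intro mult_left_mono) auto
      ultimately show ?thesis by (elim confined_mono) auto
    qed
    then have "locally_confined p"
      unfolding locally_confined_def using \<epsilon> c by (intro exI[of _ \<epsilon>] conjI exI[of _ "k + c * \<epsilon>"]) auto
    then show False using p by (simp add: F_def)
  qed
  then show ?thesis by (intro confined_compact) (auto simp: F_def)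
qed

end

subsection \<open>Energy\<close>

context vlasov
begin

definition momentum :: "real \<Rightarrow> real \<Rightarrow> real" where
  "momentum t x = (\<Sum>\<alpha>\<in>{1..N}. mom fst (f \<alpha> t x))"

definition energy :: "real \<Rightarrow> real \<Rightarrow> real" where
  "energy t x = (\<Sum>\<alpha>\<in>{1..N}. mom (\<lambda>v. sqrt (1 + (norm v)\<^sup>2)) (f \<alpha> t x)) + (E1 N e f t x)\<^sup>2 / 2"

definition total_energy :: "real \<Rightarrow> real" where
  "total_energy t = integral UNIV (energy t)"

end

text \<open>Neutrality at time \<open>a\<close> propagates by charge conservation. It makes
  \<open>E1\<close> vanish for \<open>\<bar>x\<bar>\<close> above \<open>n\<close>, so that the
  field energy is finite and the energy density is compactly supported.\<close>

locale neutral_slab = vlasov_slab +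
  assumes neutral: "(LINT x|lborel. rho N e f a x) = 0"
begin

lemma rho_total: assumes t: "t \<in> {a..b}" shows "cumul (rho N e f t) n = 0"
proof -
  have eq: "rho N e f r = (\<lambda>x. \<Sum>\<alpha>\<in>{1..N}. e \<alpha> * mom (\<lambda>_. 1) (f \<alpha> r x))" if "r \<in> {a..b}" for r
    using rho_eq[OF that] by blast
  have a: "a \<in> {a..b}" using ab by simp
  have "cumul (rho N e f t) n = cumul (rho N e f a) n"
    unfolding eq[OF t] eq[OF a] by (rule charge.total_constant[OF t a])
  also have "\<dots> = 0" using supported.lborel_integral[OF supported_rho[OF a]] neutral by simp
  finally show ?thesis .
qed

lemma E1_eq_cumul:
  assumes t: "t \<in> {a..b}"
  shows "E1 N e f t x = cumul (\<lambda>x. \<Sum>\<alpha>\<in>{1..N}. e \<alpha> * mom (\<lambda>_. 1) (f \<alpha> t x)) x"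
proof -
  have "rho N e f t = (\<lambda>x. \<Sum>\<alpha>\<in>{1..N}. e \<alpha> * mom (\<lambda>_. 1) (f \<alpha> t x))"
    using rho_eq[OF t] by blast
  then show ?thesis using E1_eq[OF t] rho_total[OF t] by simp
qed

lemma E1_outside: assumes t: "t \<in> {a..b}" and x: "n < \<bar>x\<bar>" shows "E1 N e f t x = 0"
  using x rho_total[OF t] supported.cumul_const[OF supported_rho[OF t], of x]
    supported.cumul_zero[OF supported_rho[OF t], of x]
  by (cases "x < 0") (auto simp: E1_eq[OF t])

text \<open>At zero total charge, \<open>E1\<close> is the plain primitive of the charge density,
  and charge conservation turns into Ampere's law.\<close>

lemma E1_time_derivative:
  assumes t: "t \<in> {a..b}"
  shows "((\<lambda>t. E1 N e f t x) has_real_derivative - current t x) (at t within {a..b})"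
  by (rule has_field_derivative_transform_within[OF charge.cumul_time_derivative[OF t] zero_less_one t])
     (simp add: E1_eq_cumul)

lemma cont_gamma: "continuous_on S (\<lambda>v::real \<times> real. sqrt (1 + (norm v)\<^sup>2))"
  by (intro continuous_intros)

text \<open>The particles gain energy at the rate \<open>E1 * current\<close> by
  \<open>mom_transport\<close>, and by Ampere's law the field loses exactly this. The flux is the
  first momentum because particle energy times velocity is momentum; the field contributes
  none.\<close>

sublocale energy: conservation_law energy
    "\<lambda>t x. (\<Sum>\<alpha>\<in>{1..N}. kinetic.mom_t (D \<alpha>) n (\<lambda>v. sqrt (1 + (norm v)\<^sup>2)) t x) - E1 N e f t x * current t x"
    momentum a b n
proof unfold_locales
  let ?\<gamma> = "\<lambda>v::real \<times> real. sqrt (1 + (norm v)\<^sup>2)"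
  have vhat: "?\<gamma> v * fst (vhat v) = fst v" for v
  proof -
    have "1 + (norm v)\<^sup>2 > 0" by (simp add: add_pos_nonneg)
    then have "?\<gamma> v \<noteq> 0" by simp
    then show ?thesis by (simp add: vhat_def)
  qed
  have cont_current: "continuous_on ({a..b} \<times> UNIV) (\<lambda>z. current (fst z) (snd z))"
    unfolding current_def
    by (intro continuous_intros kinetic.mom_continuous[unfolded case_prod_unfold, OF kinetic] kinetic.cont_vhat[OF kinetic])
  show "continuous_on ({a..b} \<times> UNIV) (\<lambda>(t, x). energy t x)"
    unfolding case_prod_unfold energy_def
    by (intro continuous_intros kinetic.mom_continuous[unfolded case_prod_unfold, OF kinetic] cont_gamma
        E1_continuous[unfolded case_prod_unfold]) auto
  show "continuous_on ({a..b} \<times> UNIV) (\<lambda>(t, x). (\<Sum>\<alpha>\<in>{1..N}. kinetic.mom_t (D \<alpha>) n ?\<gamma> t x) - E1 N e f t x * current t x)"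
    unfolding case_prod_unfold
    by (intro continuous_intros kinetic.mom_t_continuous[unfolded case_prod_unfold, OF kinetic] cont_gamma
        E1_continuous[unfolded case_prod_unfold] cont_current) auto
  fix t x assume t: "t \<in> {a..b}"
  have "((\<lambda>t. (E1 N e f t x)\<^sup>2 / 2) has_real_derivative - E1 N e f t x * current t x) (at t within {a..b})"
    by (rule derivative_eq_intros E1_time_derivative[OF t] refl | simp)+
  then have "(energy_x has_real_derivative (\<Sum>\<alpha>\<in>{1..N}. kinetic.mom_t (D \<alpha>) n ?\<gamma> t x) +
      - E1 N e f t x * current t x) (at t within {a..b})" if "energy_x = (\<lambda>t. energy t x)" for energy_x
    unfolding that energy_def
    by (intro DERIV_add DERIV_sum kinetic.mom_has_time_derivative[OF kinetic] t cont_gamma)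
  then show "((\<lambda>t. energy t x) has_real_derivative
      (\<Sum>\<alpha>\<in>{1..N}. kinetic.mom_t (D \<alpha>) n ?\<gamma> t x) - E1 N e f t x * current t x) (at t within {a..b})"
    by simp
  have "((\<lambda>x. mom fst (f \<alpha> t x)) has_real_derivative
      e \<alpha> * E1 N e f t x * mom (\<lambda>v. fst (vhat v)) (f \<alpha> t x) - kinetic.mom_t (D \<alpha>) n ?\<gamma> t x) (at x)"
    if \<alpha>: "\<alpha> \<in> {1..N}" for \<alpha>
  proof -
    have "(\<lambda>v. ?\<gamma> v * fst (vhat v)) = fst" using vhat by blast
    then show ?thesis
      using kinetic.mom_transport[OF kinetic[OF \<alpha>] cont_gamma t kinetic.cont_vhat[OF kinetic[OF \<alpha>]] energy_derivative, of x]
      by simp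
  qed
  then have "(momentum t has_real_derivative (\<Sum>\<alpha>\<in>{1..N}. e \<alpha> * E1 N e f t x * mom (\<lambda>v. fst (vhat v)) (f \<alpha> t x)
      - kinetic.mom_t (D \<alpha>) n ?\<gamma> t x)) (at x)"
    unfolding momentum_def by (intro DERIV_sum)
  then show "(momentum t has_real_derivative
      - ((\<Sum>\<alpha>\<in>{1..N}. kinetic.mom_t (D \<alpha>) n ?\<gamma> t x) - E1 N e f t x * current t x)) (at x)"
    by (rule DERIV_cong) (simp add: sum_subtractf current_def sum_distrib_left mult_ac)
  assume "n < \<bar>x\<bar>"
  then show "energy t x = 0" "momentum t x = 0"
    using kinetic.mom_outside[OF kinetic t] E1_outside[OF t]
    by (auto simp: energy_def momentum_def intro!: sum.neutral)
qed (use ab n in auto)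

lemma mom_gamma_nonneg:
  "\<alpha> \<in> {1..N} \<Longrightarrow> t \<in> {a..b} \<Longrightarrow> 0 \<le> mom (\<lambda>v. sqrt (1 + (norm v)\<^sup>2)) (f \<alpha> t x)"
  unfolding mom_def using ab
  by (intro integral_nonneg phase_slice.integrable_mom[OF slice] cont_gamma) (auto intro!: nonneg mult_nonneg_nonneg)

lemma energy_nonneg: "t \<in> {a..b} \<Longrightarrow> 0 \<le> energy t x"
  unfolding energy_def by (intro add_nonneg_nonneg sum_nonneg mom_gamma_nonneg) auto

lemma total_energy_eq: assumes "t \<in> {a..b}" shows "cumul (energy t) n = total_energy a"
proof -
  have "cumul (energy t) n = cumul (energy a) n"
    using ab assms by (intro energy.total_constant) auto
  also have "\<dots> = total_energy a"
    unfolding total_energy_def using ab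
    by (intro integral_unique[symmetric] supported.has_integral_UNIV energy.supported_slice) auto
  finally show ?thesis .
qed

section \<open>Energy ahead of a light ray\<close>

text \<open>The energy to the right (\<open>s = 1\<close>) or to the left (\<open>s = -1\<close>) of \<open>x\<close>.\<close>
definition ahead :: "real \<Rightarrow> real \<Rightarrow> real \<Rightarrow> real" where
  "ahead s t x = total_energy a / 2 - s * (cumul (energy t) x - total_energy a / 2)"

definition outflow :: "real \<Rightarrow> real \<Rightarrow> real \<Rightarrow> real" where
  "outflow s t x = energy t x - s * momentum t x"

lemma ahead_bounds:
  assumes "s = 1 \<or> s = -1" "t \<in> {a..b}"
  shows "0 \<le> ahead s t x" "ahead s t x \<le> total_energy a"
  using supported.cumul_bounds[OF energy.supported_slice[OF assms(2)] energy_nonneg[OF assms(2)], of x]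
    total_energy_eq[OF assms(2)] assms(1)
  by (auto simp: ahead_def)

text \<open>By \<open>energy.cumul_along\<close> the derivative is \<open>- s\<close> times
  \<open>s A - B\<close>, which is \<open>- (A - s B)\<close> because \<open>s\<close> squares to
  1.\<close>

lemma ahead_along:
  assumes s: "s = 1 \<or> s = -1" and t: "t \<in> {a..b}"
  shows "((\<lambda>t. ahead s t (c + s * t)) has_real_derivative - outflow s t (c + s * t)) (at t within {a..b})"
  unfolding ahead_def
  by (rule derivative_eq_intros energy.cumul_along[OF t] refl)+
     (use s in \<open>auto simp: outflow_def algebra_simps\<close>)

lemma outflow_continuous: "continuous_on ({a..b} \<times> UNIV) (\<lambda>(t, x). outflow s t x)"
proof -
  have "continuous_on ({a..b} \<times> UNIV) (\<lambda>z. momentum (fst z) (snd z))"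
    unfolding momentum_def
    by (intro continuous_intros kinetic.mom_continuous[unfolded case_prod_unfold, OF kinetic])
  then show ?thesis
    using energy.cont_A unfolding outflow_def case_prod_unfold by (intro continuous_intros)
qed

text \<open>With \<open>u = s * v1\<close>, the product of \<open>\<gamma> - u\<close> and
  \<open>\<gamma> + u\<close> is \<open>1 + v2^2\<close>, and for positive \<open>u\<close> the
  second factor is at most \<open>1 + 2 Q + r\<close>, hence at most \<open>2 (2 + r) Q\<close>. For
  \<open>u \<le> 0\<close> already \<open>\<gamma> - u\<close> is at least 1.\<close>

lemma cone_weight:
  fixes v1 v2 :: real
  assumes s: "s = 1 \<or> s = -1" and Q: "1 \<le> Q" "s * v1 \<le> Q" and r: "0 \<le> r" "\<bar>v2\<bar> \<le> r"
  shows "1 \<le> 2 * (2 + r) * Q * (sqrt (1 + (norm (v1, v2))\<^sup>2) - s * v1)"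
proof -
  define u where "u = s * v1"
  define \<gamma> where "\<gamma> = sqrt (1 + (norm (v1, v2))\<^sup>2)"
  have "u\<^sup>2 = v1\<^sup>2" using s by (auto simp: u_def)
  then have \<gamma>2: "\<gamma>\<^sup>2 = 1 + u\<^sup>2 + v2\<^sup>2" by (simp add: \<gamma>_def norm_Pair add.assoc)
  have \<gamma>1: "1 \<le> \<gamma>" by (simp add: \<gamma>_def)
  have up: "\<gamma> \<le> 1 + \<bar>u\<bar> + \<bar>v2\<bar>"
  proof (rule power2_le_imp_le)
    show "\<gamma>\<^sup>2 \<le> (1 + \<bar>u\<bar> + \<bar>v2\<bar>)\<^sup>2"
      unfolding \<gamma>2 by (simp add: power2_eq_square algebra_simps)
  qed simp
  have lo: "\<bar>u\<bar> \<le> \<gamma>"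
    by (rule power2_le_imp_le) (use \<gamma>2 \<gamma>1 in auto)
  have K: "1 \<le> 2 * (2 + r) * Q"
    using mult_mono[of 1 "2 * (2 + r)" 1 Q] r Q by simp
  show ?thesis
  proof (cases "u \<le> 0")
    case True
    then have "1 \<le> \<gamma> - u" using \<gamma>1 by simp
    then show ?thesis
      using mult_mono[of 1 "2 * (2 + r) * Q" 1 "\<gamma> - u"] K by (simp add: u_def \<gamma>_def)
  next
    case False
    have "r \<le> r * Q" using r Q mult_left_mono[of 1 Q r] by simp
    then have "\<gamma> + u \<le> 2 * (2 + r) * Q"
      using up False Q r unfolding u_def[symmetric] by (simp add: algebra_simps)
    then have "(\<gamma> - u) * (\<gamma> + u) \<le> (\<gamma> - u) * (2 * (2 + r) * Q)"
      using lo by (intro mult_left_mono) auto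
    moreover have "(\<gamma> - u) * (\<gamma> + u) = 1 + v2\<^sup>2" using \<gamma>2 by (simp add: power2_eq_square algebra_simps)
    ultimately have "1 + v2\<^sup>2 \<le> (\<gamma> - u) * (2 * (2 + r) * Q)" by simp
    moreover have "0 \<le> v2\<^sup>2" by simp
    ultimately have "1 \<le> (\<gamma> - u) * (2 * (2 + r) * Q)" by linarith
    then show ?thesis by (simp add: u_def \<gamma>_def mult_ac)
  qed
qed

lemma outflow_kinetic:
  assumes t: "t \<in> {a..b}"
  shows "outflow s t x = (\<Sum>\<alpha>\<in>{1..N}. mom (\<lambda>v. sqrt (1 + (norm v)\<^sup>2) - s * fst v) (f \<alpha> t x)) + (E1 N e f t x)\<^sup>2 / 2"
proof -
  have "mom (\<lambda>v. sqrt (1 + (norm v)\<^sup>2) - s * fst v) (f \<alpha> t x) =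
      mom (\<lambda>v. sqrt (1 + (norm v)\<^sup>2)) (f \<alpha> t x) - s * mom fst (f \<alpha> t x)" if \<alpha>: "\<alpha> \<in> {1..N}" for \<alpha>
  proof -
    interpret S: phase_slice "f \<alpha> t x" n by (rule slice[OF \<alpha> t])
    have "mom (\<lambda>v. sqrt (1 + (norm v)\<^sup>2) - s * fst v) (f \<alpha> t x) =
      integral UNIV (\<lambda>v. sqrt (1 + (norm v)\<^sup>2) * f \<alpha> t x v - s * (fst v * f \<alpha> t x v))"
      by (simp add: mom_def algebra_simps)
    also have "\<dots> = mom (\<lambda>v. sqrt (1 + (norm v)\<^sup>2)) (f \<alpha> t x) - s * mom fst (f \<alpha> t x)"
      unfolding mom_def
      by (subst integral_diff) (auto intro!: S.integrable_mom cont_gamma integrable_on_mult_right continuous_intros)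
    finally show ?thesis .
  qed
  then show ?thesis
    by (simp add: outflow_def energy_def momentum_def sum_subtractf sum_distrib_left)
qed

lemma mom_cone:
  assumes "s = 1 \<or> s = -1" and t: "t \<in> {a..b}" and \<alpha>: "\<alpha> \<in> {1..N}"
    and Q: "1 \<le> Q" and r: "0 \<le> r"
    and supp: "\<And>v1 v2. f \<alpha> t x (v1, v2) \<noteq> 0 \<Longrightarrow> s * v1 \<le> Q \<and> \<bar>v2\<bar> \<le> r"
  shows "mom (\<lambda>_. 1) (f \<alpha> t x) \<le> 2 * (2 + r) * Q * mom (\<lambda>v. sqrt (1 + (norm v)\<^sup>2) - s * fst v) (f \<alpha> t x)"
proof -
  interpret S: phase_slice "f \<alpha> t x" n by (rule slice[OF \<alpha> t])
  let ?w = "\<lambda>v::real \<times> real. sqrt (1 + (norm v)\<^sup>2) - s * fst v"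
  have "integral UNIV (\<lambda>v. 1 * f \<alpha> t x v) \<le> integral UNIV (\<lambda>v. 2 * (2 + r) * Q * (?w v * f \<alpha> t x v))"
  proof (rule integral_le)
    fix v :: "real \<times> real"
    obtain v1 v2 where v: "v = (v1, v2)" by (cases v)
    have f0: "0 \<le> f \<alpha> t x v" using t ab by (intro nonneg \<alpha>) auto
    show "1 * f \<alpha> t x v \<le> 2 * (2 + r) * Q * (?w v * f \<alpha> t x v)"
    proof (cases "f \<alpha> t x v = 0")
      case False
      then have "1 \<le> 2 * (2 + r) * Q * ?w v"
        using cone_weight[OF assms(1) Q _ r] supp v by simp
      then show ?thesis using mult_right_mono[OF _ f0] by (fastforce simp: mult.assoc)
    qed simp
  qed (intro S.integrable_mom integrable_on_mult_right continuous_intros)+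
  then show ?thesis by (simp add: mom_def)
qed

lemma outflow_lower:
  assumes s: "s = 1 \<or> s = -1" and t: "t \<in> {a..b}"
  shows "(E1 N e f t x)\<^sup>2 / 2 \<le> outflow s t x"
proof -
  have "0 \<le> mom (\<lambda>v. sqrt (1 + (norm v)\<^sup>2) - s * fst v) (f \<alpha> t x)" if \<alpha>: "\<alpha> \<in> {1..N}" for \<alpha>
    unfolding mom_def
  proof (intro integral_nonneg phase_slice.integrable_mom[OF slice[OF \<alpha> t]] mult_nonneg_nonneg nonneg \<alpha>)
    show "0 \<le> sqrt (1 + (norm v)\<^sup>2) - s * fst v" for v :: "real \<times> real"
    proof -
      have "norm v \<le> sqrt (1 + (norm v)\<^sup>2)" by (simp add: real_le_rsqrt)
      moreover have "\<bar>fst v\<bar> \<le> norm v" using norm_fst_le[of "fst v" "snd v"] by simp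
      ultimately show ?thesis using s by auto
    qed
  qed (use t ab in \<open>auto intro!: continuous_intros\<close>)
  then have "0 \<le> (\<Sum>\<alpha>\<in>{1..N}. mom (\<lambda>v. sqrt (1 + (norm v)\<^sup>2) - s * fst v) (f \<alpha> t x))"
    by (intro sum_nonneg)
  then show ?thesis by (simp add: outflow_kinetic[OF t])
qed

lemma number_le_outflow:
  assumes s: "s = 1 \<or> s = -1" and t: "t \<in> {a..b}" and Q: "1 \<le> Q" and r: "0 \<le> r"
    and supp: "\<And>\<alpha> v1 v2. \<alpha> \<in> {1..N} \<Longrightarrow> f \<alpha> t x (v1, v2) \<noteq> 0 \<Longrightarrow> s * v1 \<le> Q \<and> \<bar>v2\<bar> \<le> r"
  shows "number t x \<le> 2 * (2 + r) * Q * outflow s t x"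
proof -
  have "number t x \<le> 2 * (2 + r) * Q * (\<Sum>\<alpha>\<in>{1..N}. mom (\<lambda>v. sqrt (1 + (norm v)\<^sup>2) - s * fst v) (f \<alpha> t x))"
    unfolding number_def sum_distrib_left by (intro sum_mono mom_cone s t Q r supp)
  also have "\<dots> \<le> 2 * (2 + r) * Q * outflow s t x"
    unfolding outflow_kinetic[OF t] using Q r by (intro mult_left_mono) auto
  finally show ?thesis .
qed

end

subsection \<open>Growth of the momentum along a characteristic\<close>

text \<open>The derivative is required only in the open interval: below, the lower bound on the
  momentum is strict only after the initial time.\<close>

lemma nondecreasing_of_derivative_nonneg:
  fixes F :: "real \<Rightarrow> real"
  assumes "a \<le> b" "continuous_on {a..b} F"
    and "\<And>t. a < t \<Longrightarrow> t < b \<Longrightarrow> \<exists>y\<ge>0. (F has_real_derivative y) (at t)"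
  shows "F a \<le> F b"
proof (cases "a < b")
  case True
  then obtain l z where "a < z" "z < b" "(F has_real_derivative l) (at z)" "F b - F a = (b - a) * l"
    using MVT[OF True assms(2)] assms(3) by (meson real_differentiable_def)
  moreover obtain y where "y \<ge> 0" "(F has_real_derivative y) (at z)"
    using assms(3)[of z] \<open>a < z\<close> \<open>z < b\<close> by blast
  ultimately show ?thesis using True DERIV_unique[of F l z y] by (metis diff_ge_0_iff_ge less_imp_le mult_nonneg_nonneg)
qed (use \<open>a \<le> b\<close> in simp)

context neutral_slab
begin

text \<open>The field changes by the charge on the segment, which \<open>number_le_outflow\<close>
  bounds. As outflow is nonnegative, the segment may be enlarged to a fixed width \<open>d\<close>,
  giving a bound uniform in \<open>y\<close> that can be handled along a strip of rays.\<close>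

lemma field_difference:
  assumes s: "s = 1 \<or> s = -1" and t: "t \<in> {a..b}" and Q: "1 \<le> Q" and r: "0 \<le> r"
    and supp: "\<And>\<alpha> x v1 v2. \<alpha> \<in> {1..N} \<Longrightarrow> f \<alpha> t x (v1, v2) \<noteq> 0 \<Longrightarrow> \<bar>v1\<bar> \<le> Q \<and> \<bar>v2\<bar> \<le> r"
    and y: "0 \<le> y" "y \<le> d"
  shows "\<bar>E1 N e f t (z + s * y) - E1 N e f t z\<bar> \<le>
      charge_bound * (2 * (2 + r) * Q) * integral {0..d} (\<lambda>y. outflow s t (z + s * y))"
proof -
  let ?K = "charge_bound * (2 * (2 + r) * Q)"
  have "continuous_on {0..d} (\<lambda>y. (\<lambda>(t, x). outflow s t x) (t, z + s * y))"
    by (rule continuous_on_compose2[OF outflow_continuous]) (use t in \<open>auto intro!: continuous_intros\<close>)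
  then have cont: "continuous_on {0..d} (\<lambda>y. ?K * outflow s t (z + s * y))"
    by (auto intro!: continuous_intros)
  have nonneg: "0 \<le> ?K * outflow s t x" for x
  proof -
    have "0 \<le> outflow s t x" using outflow_lower[OF s t, of x] zero_le_power2[of "E1 N e f t x"] by linarith
    then show ?thesis using charge_bound(2) Q r by simp
  qed
  have "((\<lambda>y. E1 N e f t (z + s * y)) has_real_derivative rho N e f t (z + s * y) * s) (at y)" for y
    by (rule DERIV_chain2[OF E1_space_derivative[OF t]]) (auto intro!: derivative_eq_intros)
  then have int: "((\<lambda>y. rho N e f t (z + s * y) * s) has_integral (E1 N e f t (z + s * y) - E1 N e f t (z + s * 0))) {0..y}"
    using y by (intro fundamental_theorem_of_calculus)
      (auto simp flip: has_real_derivative_iff_has_vector_derivative intro: DERIV_subset)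
  have "norm (integral {0..y} (\<lambda>y. rho N e f t (z + s * y) * s)) \<le> integral {0..y} (\<lambda>y. ?K * outflow s t (z + s * y))"
  proof (rule integral_norm_bound_integral)
    show "(\<lambda>y. ?K * outflow s t (z + s * y)) integrable_on {0..y}"
      by (intro integrable_continuous_real continuous_on_subset[OF cont]) (use y in auto)
    fix u
    have "norm (rho N e f t (z + s * u) * s) = \<bar>rho N e f t (z + s * u)\<bar>" using s by auto
    also have "\<dots> \<le> charge_bound * number t (z + s * u)" by (rule rho_le_number[OF t])
    also have "\<dots> \<le> charge_bound * (2 * (2 + r) * Q * outflow s t (z + s * u))"
    proof (intro mult_left_mono charge_bound number_le_outflow[OF s t Q r])
      fix \<beta> v1 v2 assume "\<beta> \<in> {1..N}" "f \<beta> t (z + s * u) (v1, v2) \<noteq> 0"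
      from supp[OF this] show "s * v1 \<le> Q \<and> \<bar>v2\<bar> \<le> r" using s by auto
    qed
    finally show "norm (rho N e f t (z + s * u) * s) \<le> ?K * outflow s t (z + s * u)"
      by (simp add: mult.assoc)
  qed (use int in blast)
  also have "\<dots> \<le> integral {0..d} (\<lambda>y. ?K * outflow s t (z + s * y))"
    using y nonneg by (intro integral_subset_le integrable_continuous_real continuous_on_subset[OF cont]) auto
  also have "\<dots> = ?K * integral {0..d} (\<lambda>y. outflow s t (z + s * y))" by simp
  finally show ?thesis using integral_unique[OF int] by simp
qed

lemma ahead_continuous: "continuous_on ({a..b} \<times> UNIV) (\<lambda>(t, x). ahead s t x)"
  using energy.cumul_continuous unfolding ahead_def case_prod_unfold by (intro continuous_intros)

text \<open>\<open>ahead_along\<close> integrated over the parallel rays of the strip. The energy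
  lost over all times is therefore at most \<open>d\<close> times the total energy.\<close>

lemma ahead_strip_derivative:
  assumes s: "s = 1 \<or> s = -1" and t: "t \<in> {a..b}"
  shows "((\<lambda>t. integral {0..d} (\<lambda>y. ahead s t ((c + s * y) + s * t))) has_real_derivative
      - integral {0..d} (\<lambda>y. outflow s t ((c + s * y) + s * t))) (at t within {a..b})"
proof -
  have "((\<lambda>t. integral (cbox 0 d) (\<lambda>y. ahead s t ((c + s * y) + s * t))) has_real_derivative
      integral (cbox 0 d) (\<lambda>y. - outflow s t ((c + s * y) + s * t))) (at t within {a..b})"
  proof (rule leibniz_rule_field_derivative)
    show "((\<lambda>t. ahead s t ((c + s * y) + s * t)) has_real_derivative - outflow s t ((c + s * y) + s * t))
        (at t within {a..b})" if "t \<in> {a..b}" for t y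
      by (rule ahead_along[OF s that])
    show "(\<lambda>y. ahead s t ((c + s * y) + s * t)) integrable_on cbox 0 d" if "t \<in> {a..b}" for t
    proof -
      have "continuous_on {0..d} (\<lambda>y. (\<lambda>(t, x). ahead s t x) (t, (c + s * y) + s * t))"
        by (rule continuous_on_compose2[OF ahead_continuous]) (use that in \<open>auto intro!: continuous_intros\<close>)
      then show ?thesis by (auto intro: integrable_continuous_real)
    qed
    have "continuous_on ({a..b} \<times> cbox 0 d) (\<lambda>w. (\<lambda>(t, x). outflow s t x) (fst w, (c + s * snd w) + s * fst w))"
      by (rule continuous_on_compose2[OF outflow_continuous]) (auto intro!: continuous_intros)
    then show "continuous_on ({a..b} \<times> cbox 0 d) (\<lambda>(t, y). - outflow s t ((c + s * y) + s * t))"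
      by (auto simp: case_prod_unfold intro!: continuous_intros)
  qed (use t in auto)
  then show ?thesis by simp
qed

text \<open>With \<open>p = s * u\<close>, the deficit \<open>1 - p / \<gamma>\<close> equals
  \<open>(1 + w^2) / ((\<gamma> + p) \<gamma>)\<close>, and \<open>\<gamma> \<ge> p > Q / 2\<close>
  makes the denominator at least \<open>Q^2 / 2\<close>.\<close>

lemma vhat_near_light_speed:
  assumes s: "s = 1 \<or> s = -1" and Q: "1 \<le> Q" and u: "Q / 2 < s * u" and r: "\<bar>w\<bar> \<le> r"
  shows "1 - 2 * (1 + r\<^sup>2) / Q\<^sup>2 \<le> s * fst (vhat (u, w))"
proof -
  define p where "p = s * u"
  define \<gamma> where "\<gamma> = sqrt (1 + u\<^sup>2 + w\<^sup>2)"
  have p2: "p\<^sup>2 = u\<^sup>2" using s by (auto simp: p_def)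
  have \<gamma>2: "\<gamma>\<^sup>2 = 1 + p\<^sup>2 + w\<^sup>2" by (simp add: \<gamma>_def p2)
  have p: "0 < p" "Q / 2 < p" using u Q by (auto simp: p_def)
  have \<gamma>: "p \<le> \<gamma>" by (rule power2_le_imp_le) (use \<gamma>2 in \<open>auto simp: \<gamma>_def\<close>)
  have w: "w\<^sup>2 \<le> r\<^sup>2" using r by (metis abs_le_square_iff abs_ge_self order_trans)
  have "1 - p / \<gamma> = (\<gamma> - p) / \<gamma>" using p \<gamma> by (simp add: diff_divide_distrib)
  also have "\<dots> = (1 + w\<^sup>2) / ((\<gamma> + p) * \<gamma>)"
  proof -
    have "(\<gamma> - p) * (\<gamma> + p) = 1 + w\<^sup>2" using \<gamma>2 by (simp add: power2_eq_square algebra_simps)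
    then show ?thesis using p \<gamma> by (simp add: divide_simps)
  qed
  also have "\<dots> \<le> (1 + r\<^sup>2) / (Q\<^sup>2 / 2)"
  proof (rule frac_le)
    have "Q * (Q / 2) \<le> (\<gamma> + p) * \<gamma>"
      using p \<gamma> Q by (intro mult_mono) auto
    then show "Q\<^sup>2 / 2 \<le> (\<gamma> + p) * \<gamma>" by (simp add: power2_eq_square)
  qed (use w Q in auto)
  finally have "1 - p / \<gamma> \<le> 2 * (1 + r\<^sup>2) / Q\<^sup>2" by (simp add: field_simps)
  moreover have "s * fst (vhat (u, w)) = p / \<gamma>" by (simp add: fst_vhat p_def \<gamma>_def)
  ultimately show ?thesis by simp
qed

text \<open>
  A particle whose momentum is of the order of the maximal momentum \<open>Q\<close> moves almost at light speed,
  hence stays within distance \<open>O(\<tau> / Q\<^sup>2)\<close> of a light ray. On the ray, the square of the field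
  is controlled by the energy that flows out of the region ahead; off the ray, the field differs by
  the charge in between, which is at most \<open>O(Q)\<close> times this flow.
\<close>
lemma momentum_growth:
  assumes s: "s = 1 \<or> s = -1" and \<alpha>: "\<alpha> \<in> {1..N}" and Q: "1 \<le> Q" and r: "0 \<le> r"
    and supp: "\<And>\<beta> t x v1 v2. \<beta> \<in> {1..N} \<Longrightarrow> t \<in> {a..b} \<Longrightarrow> f \<beta> t x (v1, v2) \<noteq> 0 \<Longrightarrow> \<bar>v1\<bar> \<le> Q \<and> \<bar>v2\<bar> \<le> r"
    and start: "\<And>x v1 v2. f \<alpha> a x (v1, v2) \<noteq> 0 \<Longrightarrow> \<bar>v1\<bar> \<le> Q / 2"
    and nz: "f \<alpha> b x (v1, v2) \<noteq> 0" and large: "3 * Q / 4 < s * v1"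
    and \<tau>: "1 \<le> \<tau>" "b - a \<le> \<tau>"
  shows "Q / 4 \<le> charge_bound * (total_energy a + 1 / 2) * sqrt \<tau>
    + 4 * charge_bound\<^sup>2 * (2 + r) * (1 + r\<^sup>2) * total_energy a * \<tau> / Q"
proof -
  let ?E = "E1 N e f" and ?K = charge_bound and ?H = "total_energy a"
  have ss: "s * s = 1" using s by auto
  obtain L where "kinetic_lipschitz (f \<alpha>) (D \<alpha>) (\<lambda>t x. e \<alpha> * ?E t x) a b n L"
    using kinetic_lipschitz[OF \<alpha>] by blast
  from kinetic_lipschitz.characteristic[OF this disjI2[OF refl], of x v1 v2]
  obtain X V where end_point: "X b = x" "V b = v1"
    and X: "\<And>t. t \<in> {a..b} \<Longrightarrow> (X has_real_derivative fst (vhat (V t, v2))) (at t within {a..b})"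
    and V: "\<And>t. t \<in> {a..b} \<Longrightarrow> (V has_real_derivative e \<alpha> * ?E t (X t)) (at t within {a..b})"
    and f: "\<And>t. t \<in> {a..b} \<Longrightarrow> f \<alpha> t (X t) (V t, v2) = f \<alpha> b x (v1, v2)"
    by blast
  have contX: "continuous_on {a..b} X" by (rule DERIV_continuous_on) (rule X)
  have contV: "continuous_on {a..b} V" by (rule DERIV_continuous_on) (rule V)
  have v2: "\<bar>v2\<bar> \<le> r" using supp[OF \<alpha> _ nz] ab by simp
  \<comment> \<open>Its maximum \<open>t0\<close> is the last time at which the momentum is at most
    \<open>Q / 2\<close>; \<open>start\<close> ensures that there is one. From \<open>t0\<close> to
    \<open>b\<close> the momentum gains at least \<open>Q / 4\<close>.\<close>
  define S where "S = {a..b} \<inter> (\<lambda>t. s * V t) -` {..Q / 2}"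
  have "closed S" unfolding S_def
    by (intro continuous_closed_preimage continuous_intros contV closed_atMost closed_atLeastAtMost)
  moreover have "bounded S" unfolding S_def by (rule bounded_subset[of "{a..b}"]) auto
  ultimately have "compact S" by (simp add: compact_eq_bounded_closed)
  moreover have "a \<in> S"
    using start[of "X a" "V a" v2] f[of a] nz ab s by (auto simp: S_def abs_le_iff)
  ultimately obtain t0 where t0: "t0 \<in> S" and last: "\<And>t. t \<in> S \<Longrightarrow> t \<le> t0"
    using compact_attains_sup[of S] by blast
  have t0_ab: "a \<le> t0" "t0 \<le> b" and Vt0: "s * V t0 \<le> Q / 2" using t0 by (auto simp: S_def)
  have V_large: "Q / 2 < s * V t" if "t0 < t" "t < b" for t
    using last[of t] that t0_ab by (force simp: S_def)
  have at: "at t within {a..b} = at t" if "t0 < t" "t < b" for t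
    using that t0_ab by (intro at_within_Icc_at) auto
  \<comment> \<open>The speed deficit from \<open>vhat_near_light_speed\<close>, and with it the
    largest distance \<open>d\<close> from the ray.\<close>
  define k where "k = 2 * (1 + r\<^sup>2) / Q\<^sup>2"
  define d where "d = k * (b - a)"
  define c where "c = x - s * b"
  \<comment> \<open>The signed distance from the ray that meets the particle at time
    \<open>b\<close>. Being slower than light, the particle is ahead of the ray before, so
    \<open>y\<close> is nonnegative and decreases to 0.\<close>
  define y where "y t = s * X t - t - (s * x - b)" for t
  have k0: "0 \<le> k" by (simp add: k_def)
  then have d0: "0 \<le> d" using ab by (simp add: d_def)
  have y: "0 \<le> y t" "y t \<le> d" if t: "t0 \<le> t" "t \<le> b" for t
  proof -
    have cont: "continuous_on {t..b} X" by (rule continuous_on_subset[OF contX]) (use t t0_ab in auto)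
    have X': "(X has_real_derivative fst (vhat (V u, v2))) (at u)" if "t < u" "u < b" for u
      using X[of u] at[of u] that t t0_ab by auto
    have "t - s * X t \<le> b - s * X b"
    proof (rule nondecreasing_of_derivative_nonneg[where F = "\<lambda>u. u - s * X u"])
      fix u assume u: "t < u" "u < b"
      have "((\<lambda>u. u - s * X u) has_real_derivative 1 - s * fst (vhat (V u, v2))) (at u)"
        by (rule derivative_eq_intros X'[OF u] refl | simp)+
      moreover have "s * fst (vhat (V u, v2)) \<le> 1"
        using abs_fst_vhat_le[of "(V u, v2)"] s by (auto simp: abs_le_iff)
      ultimately show "\<exists>y\<ge>0. ((\<lambda>u. u - s * X u) has_real_derivative y) (at u)"
        by (intro exI[of _ "1 - s * fst (vhat (V u, v2))"]) simp
    qed (use t in \<open>auto intro!: continuous_intros cont\<close>)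
    then show "0 \<le> y t" by (simp add: y_def end_point)
    have "s * X t - t + k * t \<le> s * X b - b + k * b"
    proof (rule nondecreasing_of_derivative_nonneg[where F = "\<lambda>u. s * X u - u + k * u"])
      fix u assume u: "t < u" "u < b"
      have "((\<lambda>u. s * X u - u + k * u) has_real_derivative s * fst (vhat (V u, v2)) - 1 + k) (at u)"
        by (rule derivative_eq_intros X'[OF u] refl | simp)+
      moreover have "1 - k \<le> s * fst (vhat (V u, v2))"
        unfolding k_def using u t by (intro vhat_near_light_speed s Q V_large v2) auto
      ultimately show "\<exists>y\<ge>0. ((\<lambda>u. s * X u - u + k * u) has_real_derivative y) (at u)"
        by (intro exI[of _ "s * fst (vhat (V u, v2)) - 1 + k"]) simp
    qed (use t in \<open>auto intro!: continuous_intros cont\<close>)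
    then have "y t \<le> k * (b - t)" by (simp add: y_def end_point algebra_simps)
    also have "\<dots> \<le> d" unfolding d_def using t t0_ab k0 by (intro mult_left_mono) auto
    finally show "y t \<le> d" .
  qed
  have X_eq: "X t = (c + s * t) + s * y t" for t
  proof -
    have "s * y t = (s * s) * X t - s * t - (s * s) * x + s * b" by (simp add: y_def algebra_simps)
    then show ?thesis by (simp add: c_def ss)
  qed
  \<comment> \<open>The weight in the inequality \<open>2 \<bar>E\<bar> \<le> q E^2 + 1 / q\<close>.
    It balances the time term \<open>\<tau> / q\<close> against the energy term
    \<open>q H\<close>.\<close>
  define q where "q = sqrt \<tau>"
  have q: "0 < q" "q * q = \<tau>" "1 \<le> q" using \<tau> by (auto simp: q_def)
  define C where "C = ?K * (?K * (2 * (2 + r) * Q))"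
  have C: "0 \<le> C" using charge_bound(2) r Q by (simp add: C_def)
  define J where "J t = integral {0..d} (\<lambda>y. ahead s t ((c + s * y) + s * t))" for t
  define I where "I t = integral {0..d} (\<lambda>y. outflow s t ((c + s * y) + s * t))" for t
  \<comment> \<open>The derivative of \<open>\<Lambda>\<close> is the upper bound for the force on
    the particle minus the force itself. Monotonicity of \<open>\<Lambda>\<close> is the integrated
    estimate, obtained without time integrals.\<close>
  define \<Lambda> where "\<Lambda> t = ?K * t / (2 * q) - s * V t - ?K * q * ahead s t (c + s * t) - C * J t" for t
  have "\<Lambda> t0 \<le> \<Lambda> b"
  proof (rule nondecreasing_of_derivative_nonneg[where F = \<Lambda>])
    have \<Lambda>': "(\<Lambda> has_real_derivative ?K / (2 * q) - s * (e \<alpha> * ?E t (X t))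
        + ?K * q * outflow s t (c + s * t) + C * I t) (at t within {a..b})" if t: "t \<in> {a..b}" for t
    proof -
      have lin: "((\<lambda>t. ?K * t / (2 * q)) has_real_derivative ?K / (2 * q)) (at t within {a..b})"
        using DERIV_cmult[OF DERIV_ident, of "?K / (2 * q)"] by simp
      show ?thesis
        unfolding \<Lambda>_def J_def I_def
        by (rule DERIV_cong[OF DERIV_diff[OF DERIV_diff[OF DERIV_diff[OF lin DERIV_cmult[OF V[OF t]]]
              DERIV_cmult[OF ahead_along[OF s t]]] DERIV_cmult[OF ahead_strip_derivative[OF s t]]]]) simp
    qed
    show "continuous_on {t0..b} \<Lambda>"
    proof (rule continuous_on_subset)
      show "continuous_on {a..b} \<Lambda>" by (rule DERIV_continuous_on) (rule \<Lambda>')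
    qed (use t0_ab in auto)
    fix t assume t: "t0 < t" "t < b"
    then have t_ab: "t \<in> {a..b}" using t0_ab by auto
    let ?z = "c + s * t"
    have "\<bar>?E t (X t) - ?E t ?z\<bar> \<le> ?K * (2 * (2 + r) * Q) * integral {0..d} (\<lambda>y. outflow s t (?z + s * y))"
      unfolding X_eq using t by (intro field_difference[OF s t_ab Q r] supp y) (use t_ab in auto)
    also have "integral {0..d} (\<lambda>y. outflow s t (?z + s * y)) = I t"
      unfolding I_def by (intro integral_cong arg_cong[where f = "outflow s t"]) simp
    finally have diff: "\<bar>?E t (X t) - ?E t ?z\<bar> \<le> ?K * (2 * (2 + r) * Q) * I t" .
    have ray: "\<bar>?E t ?z\<bar> \<le> q * outflow s t ?z + 1 / (2 * q)"
    proof -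
      have "2 * (q * \<bar>?E t ?z\<bar>) \<le> (q * \<bar>?E t ?z\<bar>)\<^sup>2 + 1"
        using sum_squares_bound[of "q * \<bar>?E t ?z\<bar>" 1] by simp
      then have "\<bar>?E t ?z\<bar> \<le> q * ((?E t ?z)\<^sup>2 / 2) + 1 / (2 * q)"
        using q(1) by (simp add: field_simps power2_eq_square)
      also have "\<dots> \<le> q * outflow s t ?z + 1 / (2 * q)"
        using q(1) outflow_lower[OF s t_ab, of ?z] by (intro add_right_mono mult_left_mono) auto
      finally show ?thesis .
    qed
    have "s * (e \<alpha> * ?E t (X t)) \<le> \<bar>e \<alpha>\<bar> * \<bar>?E t (X t)\<bar>"
      using s abs_ge_self[of "e \<alpha> * ?E t (X t)"] abs_ge_minus_self[of "e \<alpha> * ?E t (X t)"] by (auto simp: abs_mult)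
    also have "\<dots> \<le> ?K * \<bar>?E t (X t)\<bar>" by (intro mult_right_mono charge_bound \<alpha>) auto
    also have "\<dots> \<le> ?K * (q * outflow s t ?z + 1 / (2 * q) + ?K * (2 * (2 + r) * Q) * I t)"
      using diff ray by (intro mult_left_mono charge_bound) linarith+
    also have "\<dots> = ?K / (2 * q) + ?K * q * outflow s t ?z + C * I t" by (simp add: C_def algebra_simps)
    finally have "0 \<le> ?K / (2 * q) - s * (e \<alpha> * ?E t (X t)) + ?K * q * outflow s t ?z + C * I t" by simp
    then show "\<exists>y\<ge>0. (\<Lambda> has_real_derivative y) (at t)"
      using \<Lambda>'[OF t_ab] unfolding at[OF t] by blast
  qed (use t0_ab in simp)
  then have gain: "s * V b - s * V t0 \<le> ?K * (b - t0) / (2 * q)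
      + (?K * q * ahead s t0 (c + s * t0) - ?K * q * ahead s b (c + s * b)) + (C * J t0 - C * J b)"
    by (simp add: \<Lambda>_def algebra_simps diff_divide_distrib)
  have time: "?K * (b - t0) / (2 * q) \<le> ?K * (q / 2)"
  proof -
    have "(b - t0) / (2 * q) \<le> q / 2"
      using q \<tau> t0_ab by (simp add: divide_simps)
    from mult_left_mono[OF this charge_bound(2)] show ?thesis by simp
  qed
  have ray: "?K * q * ahead s t0 (c + s * t0) - ?K * q * ahead s b (c + s * b) \<le> ?K * q * ?H"
  proof -
    have "0 \<le> ?K * q * ahead s b (c + s * b)"
      using ahead_bounds(1)[OF s, of b] charge_bound(2) q ab by simp
    moreover have "?K * q * ahead s t0 (c + s * t0) \<le> ?K * q * ?H"
      using ahead_bounds(2)[OF s, of t0] charge_bound(2) q t0_ab by (intro mult_left_mono) auto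
    ultimately show ?thesis by linarith
  qed
  have strip: "C * J t0 - C * J b \<le> C * (d * ?H)"
  proof -
    have int: "(\<lambda>y. ahead s t ((c + s * y) + s * t)) integrable_on {0..d}" if "t \<in> {a..b}" for t
    proof -
      have "continuous_on {0..d} (\<lambda>y. (\<lambda>(t, x). ahead s t x) (t, (c + s * y) + s * t))"
        by (rule continuous_on_compose2[OF ahead_continuous]) (use that in \<open>auto intro!: continuous_intros\<close>)
      then show ?thesis by (auto intro: integrable_continuous_real)
    qed
    have "0 \<le> J b" unfolding J_def
      using ab by (intro integral_nonneg int ahead_bounds s) auto
    moreover have "J t0 \<le> integral {0..d} (\<lambda>_. ?H)" unfolding J_def
      using t0_ab by (intro integral_le int ahead_bounds s) auto
    then have "J t0 \<le> d * ?H" using d0 by simp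
    ultimately have "J t0 - J b \<le> d * ?H" by simp
    then show ?thesis using mult_left_mono[OF _ C, of "J t0 - J b"] by (simp add: right_diff_distrib)
  qed
  \<comment> \<open>\<open>C\<close> carries a factor \<open>Q\<close> and \<open>d\<close> a factor
    \<open>1 / Q^2\<close>, which leaves \<open>1 / Q\<close>.\<close>
  have small: "C * (d * ?H) \<le> 4 * ?K\<^sup>2 * (2 + r) * (1 + r\<^sup>2) * ?H * \<tau> / Q"
  proof -
    have "0 \<le> ?H" using ahead_bounds[OF s, of a 0] ab by auto
    moreover have "C * d = (4 * ?K\<^sup>2 * (2 + r) * (1 + r\<^sup>2) / Q) * (b - a)"
      using Q by (simp add: C_def d_def k_def power2_eq_square field_simps)
    moreover have "(4 * ?K\<^sup>2 * (2 + r) * (1 + r\<^sup>2) / Q) * (b - a) \<le> (4 * ?K\<^sup>2 * (2 + r) * (1 + r\<^sup>2) / Q) * \<tau>"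
      using \<tau> Q r by (intro mult_left_mono) auto
    ultimately have "C * d * ?H \<le> (4 * ?K\<^sup>2 * (2 + r) * (1 + r\<^sup>2) / Q) * \<tau> * ?H"
      by (metis mult_right_mono)
    then show ?thesis by (simp add: mult_ac)
  qed
  have "Q / 4 \<le> s * V b - s * V t0" using large Vt0 end_point by simp
  also have "\<dots> \<le> ?K * (q / 2) + ?K * q * ?H + 4 * ?K\<^sup>2 * (2 + r) * (1 + r\<^sup>2) * ?H * \<tau> / Q"
    using gain time ray strip small by linarith
  also have "?K * (q / 2) + ?K * q * ?H = ?K * (?H + 1 / 2) * sqrt \<tau>"
    by (simp add: q_def algebra_simps)
  finally show ?thesis .
qed

end

subsection \<open>The square root bound\<close>

text \<open>\<open>v2\<close> is constant along the characteristic that leads back to time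
  \<open>a\<close>.\<close>

lemma (in vlasov_slab) transverse_bound:
  assumes \<alpha>: "\<alpha> \<in> {1..N}" and "confined r a" and nz: "f \<alpha> b x (v1, v2) \<noteq> 0"
  shows "\<bar>v2\<bar> \<le> r"
proof -
  obtain L where "kinetic_lipschitz (f \<alpha>) (D \<alpha>) (\<lambda>t x. e \<alpha> * E1 N e f t x) a b n L"
    using kinetic_lipschitz[OF \<alpha>] by blast
  from kinetic_lipschitz.characteristic[OF this disjI2[OF refl], of x v1 v2]
  obtain X V where "\<And>t. t \<in> {a..b} \<Longrightarrow> f \<alpha> t (X t) (V t, v2) = f \<alpha> b x (v1, v2)" by blast
  then have "f \<alpha> a (X a) (V a, v2) = f \<alpha> b x (v1, v2)" using ab by simp
  then have "norm (V a, v2) \<le> r"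
    using assms(2) \<alpha> nz unfolding confined_def by metis
  then show ?thesis using norm_snd_le[of v2 "V a"] by simp
qed

text \<open>For each \<open>T\<close>, \<open>momentum_growth\<close> is applied with
  \<open>Q\<close> the supremum of \<open>\<bar>v1\<bar>\<close> on the supports up to
  \<open>T\<close>. The radius \<open>n\<close>, which may depend on \<open>T\<close>, makes
  \<open>Q\<close> finite but does not enter \<open>C\<close>.\<close>

lemma (in vlasov) momentum_bound:
  assumes neutral: "(LINT x|lborel. rho N e f 0 x) = 0"
  shows "\<exists>C>0. \<forall>t\<ge>0. \<forall>\<alpha>\<in>{1..N}. \<forall>x v1 v2. f \<alpha> t x (v1, v2) \<noteq> 0 \<longrightarrow> \<bar>v1\<bar> \<le> C * sqrt (1 + t)"
proof -
  obtain r0 :: nat where r0: "confined (real r0) 0" using confined_exists[of 0] by auto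
  define r where "r = real r0"
  have r: "0 \<le> r" "confined r 0" using r0 by (auto simp: r_def)
  have neutral_slab: "neutral_slab N e f D 0 b n" if "vlasov_slab N e f D 0 b n" for b n
    using that neutral by (simp add: neutral_slab_def neutral_slab_axioms_def)
  define H where "H = total_energy 0"
  have H: "0 \<le> H"
  proof -
    interpret neutral_slab N e f D 0 0 r
      using r by (intro neutral_slab slabI) auto
    show ?thesis using ahead_bounds[of 1 0 0] by (simp add: H_def)
  qed
  define A where "A = charge_bound * (H + 1 / 2)"
  define B where "B = 4 * charge_bound\<^sup>2 * (2 + r) * (1 + r\<^sup>2) * H"
  have AB: "0 \<le> A" "0 \<le> B" using charge_bound(2) r H by (auto simp: A_def B_def)
  \<comment> \<open>The three summands yield, in turn, \<open>1 \<le> Q\<close> with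
    \<open>q \<le> Q\<close>, initial momenta at most \<open>Q / 2\<close>, and the final
    contradiction.\<close>
  define C where "C = 1 + 2 * r + 4 * (A + B)"
  have "\<bar>v1\<bar> \<le> C * sqrt (1 + T)" if T: "0 \<le> T" and \<alpha>: "\<alpha> \<in> {1..N}" and nz: "f \<alpha> T x (v1, v2) \<noteq> 0" for T \<alpha> x v1 v2
  proof (rule ccontr)
    assume contra: "\<not> \<bar>v1\<bar> \<le> C * sqrt (1 + T)"
    obtain n where n: "0 \<le> n" "\<And>t. t \<in> {0..T} \<Longrightarrow> confined n t" using confined_on_bounded_times by blast
    define P where "P = {\<bar>w1\<bar> | w1. \<exists>t\<in>{0..T}. \<exists>\<beta>\<in>{1..N}. \<exists>y w2. f \<beta> t y (w1, w2) \<noteq> 0}"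
    have slab: "neutral_slab N e f D 0 t n" if "t \<in> {0..T}" for t
      using n that by (intro neutral_slab slabI) auto
    have "bdd_above P"
    proof (rule bdd_aboveI)
      fix p assume "p \<in> P"
      then obtain w1 t \<beta> y w2 where "p = \<bar>w1\<bar>" "t \<in> {0..T}" "\<beta> \<in> {1..N}" "f \<beta> t y (w1, w2) \<noteq> 0"
        by (auto simp: P_def)
      then have "p = \<bar>w1\<bar>" "norm (w1, w2) \<le> n" using n(2) unfolding confined_def by blast+
      then show "p \<le> n" using norm_fst_le[of w1 w2] by simp
    qed
    define Q where "Q = Sup P"
    have Q_upper: "\<bar>w1\<bar> \<le> Q" if "t \<in> {0..T}" "\<beta> \<in> {1..N}" "f \<beta> t y (w1, w2) \<noteq> 0" for t \<beta> y w1 w2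
    proof -
      have "\<bar>w1\<bar> \<in> P" unfolding P_def using that by blast
      then show ?thesis unfolding Q_def by (rule cSup_upper[OF _ \<open>bdd_above P\<close>])
    qed
    have "T \<in> {0..T}" using T by simp
    then have v1P: "\<bar>v1\<bar> \<in> P" unfolding P_def using \<alpha> nz by blast
    define q where "q = sqrt (1 + T)"
    have q: "1 \<le> q" "q * q = 1 + T" using T by (auto simp: q_def)
    have C1: "1 \<le> C" "2 * r \<le> C" "4 * (A + B) \<le> C" using AB r by (auto simp: C_def)
    have Q_large: "C * q < Q" using contra Q_upper[OF _ \<alpha> nz] T by (auto simp: q_def)
    have "C \<le> C * q" using C1 q mult_left_mono[of 1 q C] by simp
    then have Q: "1 \<le> Q" "2 * r \<le> Q" "0 < Q" using Q_large C1 by linarith+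
    have "1 * q \<le> C * q" using C1 q by (intro mult_right_mono) auto
    then have "q \<le> Q" using Q_large by simp
    \<comment> \<open>The supremum need not be attained; a value above \<open>3 * Q / 4\<close>
      still exceeds the threshold \<open>Q / 2\<close> by \<open>Q / 4\<close>.\<close>
    have "3 * Q / 4 < Sup P" using Q by (simp add: Q_def[symmetric])
    then obtain p where "p \<in> P" "3 * Q / 4 < p" using less_cSupE v1P by blast
    then obtain w1 t \<beta> y w2 where w: "3 * Q / 4 < \<bar>w1\<bar>" and t: "t \<in> {0..T}" and \<beta>: "\<beta> \<in> {1..N}"
      and wnz: "f \<beta> t y (w1, w2) \<noteq> 0"
      unfolding P_def by blast
    interpret S: neutral_slab N e f D 0 t n by (rule slab[OF t])
    define s :: real where "s = (if 0 \<le> w1 then 1 else - 1)"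
    have "Q / 4 \<le> charge_bound * (total_energy 0 + 1 / 2) * sqrt (1 + T)
      + 4 * charge_bound\<^sup>2 * (2 + r) * (1 + r\<^sup>2) * total_energy 0 * (1 + T) / Q"
    proof (rule S.momentum_growth[OF _ \<beta> Q(1) r(1) _ _ wnz])
      show "s = 1 \<or> s = -1" by (simp add: s_def)
      show "3 * Q / 4 < s * w1" using w by (simp add: s_def abs_if split: if_splits)
      fix \<gamma> u x p1 p2 assume u: "\<gamma> \<in> {1..N}" "u \<in> {0..t}" and g: "f \<gamma> u x (p1, p2) \<noteq> 0"
      have uT: "u \<in> {0..T}" using u t by auto
      interpret U: neutral_slab N e f D 0 u n by (rule slab[OF uT])
      show "\<bar>p1\<bar> \<le> Q \<and> \<bar>p2\<bar> \<le> r"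
        using Q_upper[OF uT u(1) g] U.transverse_bound[OF u(1) r(2) g] by simp
    next
      fix x p1 p2 assume "f \<beta> 0 x (p1, p2) \<noteq> 0"
      then have "norm (p1, p2) \<le> r" using r(2) \<beta> by (auto simp: confined_def)
      then show "\<bar>p1\<bar> \<le> Q / 2" using norm_fst_le[of p1 p2] Q by simp
    qed (use t T in auto)
    then have "Q / 4 \<le> A * q + B * ((1 + T) / Q)" by (simp add: A_def B_def H_def q_def)
    \<comment> \<open>This closes the estimate: \<open>1 + T\<close> is \<open>q * q\<close>, and
      \<open>q \<le> Q\<close>.\<close>
    moreover have "(1 + T) / Q \<le> q"
      using \<open>q \<le> Q\<close> q Q mult_left_mono[of q Q q] by (simp add: divide_le_eq)
    then have "B * ((1 + T) / Q) \<le> B * q" by (rule mult_left_mono[OF _ AB(2)])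
    ultimately have "Q / 4 \<le> A * q + B * q" by linarith
    then have "Q \<le> 4 * (A + B) * q" by (simp add: algebra_simps)
    also have "\<dots> \<le> C * q" using C1 q by (intro mult_right_mono) auto
    finally show False using Q_large by simp
  qed
  moreover have "0 < C" using AB r by (simp add: C_def)
  ultimately show ?thesis by blast
qed

section \<open>From the given notion of solution to the momentum estimate\<close>

lemma at_within_Ici_neq_bot: "0 \<le> t \<Longrightarrow> at t within {0..} \<noteq> bot" for t :: real
  using trivial_limit_at_right_real[of t] at_le[of "{t<..}" "{0..}" t]
  by (metis atLeast_iff bot.extremum_uniqueI greaterThan_iff less_imp_le order_trans subsetI)

text \<open>Uniqueness of derivatives, one-sided in time at 0, identifies the partial derivatives of
  the definition with \<open>D\<close> on the coordinate directions. By linearity the equation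
  becomes the directional derivative in \<open>transport\<close>.\<close>

lemma vlasov_poisson_solution_vlasov:
  assumes "vlasov_poisson_solution N e f"
  shows "\<exists>D. vlasov N e f D"
proof -
  let ?f = "\<lambda>\<alpha> (t, x, v). f \<alpha> t x v"
  have "\<forall>\<alpha>\<in>{1..N}. \<exists>D. (\<forall>z\<in>{0..} \<times> UNIV. (?f \<alpha> has_derivative blinfun_apply (D z)) (at z within {0..} \<times> UNIV))
      \<and> continuous_on ({0..} \<times> UNIV) D"
    using assms unfolding vlasov_poisson_solution_def C1_on_def by blast
  from bchoice[OF this] obtain D where *: "\<forall>\<alpha>\<in>{1..N}.
      (\<forall>z\<in>{0..} \<times> UNIV. (?f \<alpha> has_derivative blinfun_apply (D \<alpha> z)) (at z within {0..} \<times> UNIV))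
      \<and> continuous_on ({0..} \<times> UNIV) (D \<alpha>)" by blast
  then have D: "(?f \<alpha> has_derivative blinfun_apply (D \<alpha> z)) (at z within {0..} \<times> UNIV)"
    if "\<alpha> \<in> {1..N}" "z \<in> {0..} \<times> UNIV" for \<alpha> z using that by blast
  have "vlasov N e f D"
  proof (unfold_locales)
    fix \<alpha> :: nat and t x :: real and v :: "real \<times> real" assume \<alpha>: "\<alpha> \<in> {1..N}" and t: "0 \<le> t"
    obtain v1 v2 where v: "v = (v1, v2)" by (cases v)
    obtain ft fx fv1 where
      ft: "((\<lambda>s. f \<alpha> s x (v1, v2)) has_real_derivative ft) (at t within {0..})" and
      fx: "((\<lambda>y. f \<alpha> t y (v1, v2)) has_real_derivative fx) (at x)" and
      fv1: "((\<lambda>w. f \<alpha> t x (w, v2)) has_real_derivative fv1) (at v1)" and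
      eq: "ft + fst (vhat (v1, v2)) * fx + e \<alpha> * E1 N e f t x * fv1 = 0"
      using assms \<alpha> t unfolding vlasov_poisson_solution_def by blast
    let ?D = "blinfun_apply (D \<alpha> (t, x, v))"
    have Dz: "(?f \<alpha> has_derivative ?D) (at (t, x, v1, v2) within {0..} \<times> UNIV)"
      using D[OF \<alpha>, of "(t, x, v)"] t v by simp
    have "((\<lambda>s. (s, x, v1, v2)) has_vector_derivative (1, 0, 0, 0)) (at t within {0..})"
      by (auto intro!: derivative_eq_intros has_vector_derivative_Pair simp: zero_prod_def)
    from has_derivative_along[where c = "\<lambda>s. (s, x, v1, v2)", OF Dz this]
    have "((\<lambda>s. f \<alpha> s x (v1, v2)) has_vector_derivative ?D (1, 0, 0, 0)) (at t within {0..})" by auto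
    then have 1: "?D (1, 0, 0, 0) = ft"
      using ft at_within_Ici_neq_bot[OF t]
      by (auto simp: has_real_derivative_iff_has_vector_derivative intro: vector_derivative_unique_within)
    have "((\<lambda>y. (t, y, v1, v2)) has_vector_derivative (0, 1, 0, 0)) (at x)"
      by (auto intro!: derivative_eq_intros has_vector_derivative_Pair simp: zero_prod_def)
    from has_derivative_along[where c = "\<lambda>y. (t, y, v1, v2)", OF Dz this] t
    have "((\<lambda>y. f \<alpha> t y (v1, v2)) has_vector_derivative ?D (0, 1, 0, 0)) (at x)" by auto
    then have 2: "?D (0, 1, 0, 0) = fx"
      using fx by (auto simp: has_real_derivative_iff_has_vector_derivative intro: vector_derivative_unique_at)
    have "((\<lambda>w. (t, x, w, v2)) has_vector_derivative (0, 0, 1, 0)) (at v1)"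
      by (auto intro!: derivative_eq_intros has_vector_derivative_Pair simp: zero_prod_def)
    from has_derivative_along[where c = "\<lambda>w. (t, x, w, v2)", OF Dz this] t
    have "((\<lambda>w. f \<alpha> t x (w, v2)) has_vector_derivative ?D (0, 0, 1, 0)) (at v1)" by auto
    then have 3: "?D (0, 0, 1, 0) = fv1"
      using fv1 by (auto simp: has_real_derivative_iff_has_vector_derivative intro: vector_derivative_unique_at)
    have "?D ((1, 0, 0, 0) + fst (vhat v) *\<^sub>R (0, 1, 0, 0) + (e \<alpha> * E1 N e f t x) *\<^sub>R (0, 0, 1, 0)) = 0"
      using eq by (simp only: blinfun.add_right blinfun.scaleR_right 1[unfolded v] 2[unfolded v] 3[unfolded v] v real_scaleR_def)
    then show "?D (1, fst (vhat v), e \<alpha> * E1 N e f t x, 0) = 0" by simp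
  qed (use assms D * in \<open>auto simp: vlasov_poisson_solution_def\<close>)
  then show ?thesis by blast
qed

theorem theorem1p4:
  fixes N :: nat
    and e :: "nat \<Rightarrow> real"
    and f0 :: "nat \<Rightarrow> real \<Rightarrow> real \<times> real \<Rightarrow> real"
    and f :: "nat \<Rightarrow> real \<Rightarrow> real \<Rightarrow> real \<times> real \<Rightarrow> real"
  assumes "N \<ge> 1"
    and "\<And>\<alpha> x v. \<alpha> \<in> {1..N} \<Longrightarrow> f0 \<alpha> x v \<ge> 0"
    and "\<And>\<alpha>. \<alpha> \<in> {1..N} \<Longrightarrow> C1_on UNIV (\<lambda>(x, v). f0 \<alpha> x v)"
    and "\<And>\<alpha>. \<alpha> \<in> {1..N} \<Longrightarrow> compactly_supported (\<lambda>(x, v). f0 \<alpha> x v)"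
    and "(LINT x|lborel. (LINT v|lborel. (\<Sum>\<alpha>\<in>{1..N}. e \<alpha> * f0 \<alpha> x v))) = 0"
    and "vlasov_poisson_solution N e f"
    and "\<And>\<alpha> x v. \<alpha> \<in> {1..N} \<Longrightarrow> f \<alpha> 0 x v = f0 \<alpha> x v"
  shows "\<exists>C>0. \<forall>t\<ge>0. Q1 N f t \<le> C * sqrt (1 + t)"
proof -
  obtain D where "vlasov N e f D" using vlasov_poisson_solution_vlasov[OF assms(6)] by blast
  then interpret vlasov N e f D .
  have "rho N e f 0 x = (LINT v|lborel. (\<Sum>\<alpha>\<in>{1..N}. e \<alpha> * f0 \<alpha> x v))" for x
    unfolding rho_def using assms(7) by simp
  then have "(LINT x|lborel. rho N e f 0 x) = 0" using assms(5) by simp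
  from momentum_bound[OF this] obtain C where C: "C > 0"
    and bound: "\<And>t \<alpha> x v1 v2. 0 \<le> t \<Longrightarrow> \<alpha> \<in> {1..N} \<Longrightarrow> f \<alpha> t x (v1, v2) \<noteq> 0 \<Longrightarrow> \<bar>v1\<bar> \<le> C * sqrt (1 + t)"
    by blast
  have "Q1 N f t \<le> C * sqrt (1 + t)" if t: "0 \<le> t" for t
  proof -
    define A where "A = {\<bar>v1\<bar> | v1. \<exists>x v2. (\<Sum>\<alpha>\<in>{1..N}. f \<alpha> t x (v1, v2)) \<noteq> 0}"
    have "a \<le> C * sqrt (1 + t)" if a: "a \<in> A" for a
    proof -
      obtain v1 x v2 where "a = \<bar>v1\<bar>" "(\<Sum>\<alpha>\<in>{1..N}. f \<alpha> t x (v1, v2)) \<noteq> 0" using a by (auto simp: A_def)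
      moreover then obtain \<alpha> where "\<alpha> \<in> {1..N}" "f \<alpha> t x (v1, v2) \<noteq> 0" by (meson sum.neutral)
      ultimately show ?thesis using bound[OF t] by blast
    qed
    then have "A \<noteq> {} \<Longrightarrow> Sup A \<le> C * sqrt (1 + t)" by (intro cSup_least) auto
    moreover have "Q1 N f t = (if A = {} then 0 else Sup A)" by (simp add: Q1_def A_def)
    ultimately show ?thesis using C t by simp
  qed
  then show ?thesis using C by blast
qed

end
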